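(* Let $D\subset\mathbb{R}^3$ be open and let $\phi:D\to\mathbb{R}$ be a $C^1$ function which satisfies either (A) $\phi$ is non-stationary and satisfies the angle monotonicity condition; $\phi$ and $\nabla_x\phi$ both extend continuously to $\overline D$, with $\nabla_x\phi$ nonzero on $\overline D$; and $D_\alpha$ is convex for all $\alpha\in\mathbb{R}$; or, more generally, (B) $\phi$ is admissible. For $x\in\mathbb{R}^2$ let $A_x=\{\alpha\in\mathbb{R}:(\alpha,x)\in D\}$, let $X=\{x\in\mathbb{R}^2:A_x\ne\varnothing\}$, let $\mathcal{A}=\bigcup_{x\in\mathbb{R}^2}A_x$, and for $x\in X$ let $$S_x=\{(\alpha,\phi_\alpha(x)):\alpha\in A_x\}\subset\mathbb{R}^2 .$$ Then the family $\mathcal{F}=\{S_x:x\in X\}$ yields efficient coverings of subsets of $\bigcup_{\alpha\in\mathcal{A}}\{\alpha\}\times\phi_\alpha(D_\alpha)$.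
   Context: Efficient coverings: for $S\subset\mathbb{R}^2$, a parameterized family of sets $\{S_x:x\in X\}$ in $\mathbb{R}^2$ yields efficient coverings of subsets of $S$ if for every (Lebesgue) measurable $F\subset S$ there exists $E\subset X$ such that $\bigcup_{x\in E}S_x\supset F$ and $\left|\left(\bigcup_{x\in E}S_x\right)\setminus F\right|=0$, where $|\cdot|$ is Lebesgue measure. View $\mathbb{R}^3$ as $\mathbb{R}\times\mathbb{R}^2$ with points written $(\alpha,x)$. For open $D\subset\mathbb{R}^3$ and $\phi:D\to\mathbb{R}$, put $D_\alpha=\{x\in\mathbb{R}^2:(\alpha,x)\in D\}$ (and $D'_\alpha$ likewise for $D'\subset D$) and $\phi_\alpha:D_\alpha\to\mathbb{R}$, $\phi_\alpha(x)=\phi(\alpha,x)$. $\nabla\phi_\alpha(x)=\nabla_x\phi(\alpha,x)$ is the gradient in $x$ only. $|L|$ is the length of a line segment $L$, and $\operatorname{nbhd}_{\delta}(E)$ is the open $\delta$-neighborhood of $E$. Directions: $\theta\in\mathbb{R}/\pi\mathbb{Z}$ is identified with the unoriented direction $\pm(\cos\theta,\sin\theta)$; $|\theta_1-\theta_2|$ is the distance in $\mathbb{R}/\pi\mathbb{Z}$. $\phi$ is non-stationary if $\nabla\phi_\alpha(x)\ne0$ for all $(\alpha,x)\in D$; then $\theta_\alpha(x)\in\mathbb{R}/\pi\mathbb{Z}$ denotes the direction perpendicular to $\nabla\phi_\alpha(x)$. Angle monotonicity condition: for each fixed $x$ there is a choice of representatives $[a,a+\pi)$ for $\mathbb{R}/\pi\mathbb{Z}$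 such that $\alpha\mapsto\theta_\alpha(x)$ is strictly increasing as a function $\{\alpha:(\alpha,x)\in D\}\to[a,a+\pi)$. Rectangle squishing condition: for every bounded $D'\subset D$ and every $\epsilon>0$ there is $\delta=\delta(D',\epsilon)>0$ such that: if $L\subset\mathbb{R}^2$ is a line segment of length $|L|\le\delta$ with direction $\theta_L$, and $\alpha\in\mathbb{R}$ is such that there exists $x\in D'_\alpha\cap\operatorname{nbhd}_{\delta|L|}(L)$ with $|\theta_\alpha(x)-\theta_L|\le\delta$, then $\phi_\alpha(\operatorname{nbhd}_{\delta|L|}(L)\cap D_\alpha)$ is contained in an interval of length at most $\epsilon|L|$. Admissible: $\phi:D\to\mathbb{R}$ is $C^1$, non-stationary, and satisfies the angle monotonicity condition and the rectangle squishing condition. *)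

theory Defs
  imports "HOL-Analysis.Analysis"
begin

text \<open>The plane is \<^typ>\<open>real \<times> real\<close> and three-space is \<^typ>\<open>real \<times> (real \<times> real)\<close>, with points
  \<open>(\<alpha>, x)\<close>. A function on \<open>D\<close> is represented by a total function; everything below depends only on
  its values on \<open>D\<close> (derivatives are taken at points of \<open>D\<close>, which is open).\<close>

type_synonym plane = "real \<times> real"
type_synonym space = "real \<times> plane"

definition yields_efficient_coverings :: "'i set \<Rightarrow> ('i \<Rightarrow> plane set) \<Rightarrow> plane set \<Rightarrow> bool" where
  "yields_efficient_coverings X S T \<longleftrightarrow>
    (\<forall>F. F \<in> sets lebesgue \<and> F \<subseteq> T \<longrightarrow>
      (\<exists>E\<subseteq>X. F \<subseteq> (\<Union>x\<in>E. S x) \<and> (\<Union>x\<in>E. S x) - F \<in> null_sets lebesgue))"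

definition slice :: "space set \<Rightarrow> real \<Rightarrow> plane set" where
  "slice D \<alpha> = {x. (\<alpha>, x) \<in> D}"

definition param_set :: "space set \<Rightarrow> plane \<Rightarrow> real set" where
  "param_set D x = {\<alpha>. (\<alpha>, x) \<in> D}"

definition C1_on :: "(space \<Rightarrow> real) \<Rightarrow> space set \<Rightarrow> bool" where
  "C1_on \<phi> D \<longleftrightarrow>
    (\<exists>\<phi>' :: space \<Rightarrow> (space \<Rightarrow>\<^sub>L real).
      (\<forall>p\<in>D. (\<phi> has_derivative blinfun_apply (\<phi>' p)) (at p)) \<and> continuous_on D \<phi>')"

definition slice_grad :: "(space \<Rightarrow> real) \<Rightarrow> real \<Rightarrow> plane \<Rightarrow> plane" where
  "slice_grad \<phi> \<alpha> x = (THE g. GDERIV (\<lambda>y. \<phi> (\<alpha>, y)) x :> g)"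

definition non_stationary :: "(space \<Rightarrow> real) \<Rightarrow> space set \<Rightarrow> bool" where
  "non_stationary \<phi> D \<longleftrightarrow> (\<forall>\<alpha> x. (\<alpha>, x) \<in> D \<longrightarrow> slice_grad \<phi> \<alpha> x \<noteq> 0)"

text \<open>An element of \<open>\<real>/\<pi>\<int>\<close> is represented by the coset \<open>{t + k\<pi> | k \<in> \<int>}\<close> of its representatives. Thus
  the unoriented direction of a nonzero vector \<open>v\<close> is the set of all \<open>t\<close> such that \<open>v\<close> is parallel to
  \<open>(cos t, sin t)\<close>; for nonzero \<open>v\<close> the sets \<open>direction v\<close> and \<open>perp_direction v\<close> are such cosets (see
  the two lemmas below). The distance in \<open>\<real>/\<pi>\<int>\<close> is the distance \<^const>\<open>setdist\<close> between cosets.\<close>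

definition direction :: "plane \<Rightarrow> real set" where
  "direction v = {t. \<exists>r. v = r *\<^sub>R (cos t, sin t)}"

definition perp_direction :: "plane \<Rightarrow> real set" where
  "perp_direction v = {t. v \<bullet> (cos t, sin t) = 0}"

lemma perp_direction_coset:
  assumes "v \<noteq> 0" "t \<in> perp_direction v"
  shows "perp_direction v = {t + of_int k * pi | k. True}"
proof -
  obtain a b where v: "v = (a, b)" by (cases v)
  have ab: "a \<noteq> 0 \<or> b \<noteq> 0" using assms(1) v by (auto simp: zero_prod_def)
  have t: "a * cos t + b * sin t = 0" using assms(2) by (simp add: perp_direction_def v)
  have "a * cos s + b * sin s = 0 \<longleftrightarrow> sin (s - t) = 0" for s
  proof
    assume s: "a * cos s + b * sin s = 0"
    have act: "a * cos t = - b * sin t" and acs: "a * cos s = - b * sin s" using s t by linarith+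
    have bst: "b * sin t = - a * cos t" and bss: "b * sin s = - a * cos s" using s t by linarith+
    have "a * sin (s - t) = (a * cos t) * sin s - (a * cos s) * sin t"
      by (simp add: sin_diff algebra_simps)
    also have "\<dots> = (- b * sin t) * sin s - (- b * sin s) * sin t"
      unfolding act acs by simp
    finally have 1: "a * sin (s - t) = 0" by simp
    have "b * sin (s - t) = (b * sin s) * cos t - (b * sin t) * cos s"
      by (simp add: sin_diff algebra_simps)
    also have "\<dots> = (- a * cos s) * cos t - (- a * cos t) * cos s"
      using bst bss by simp
    finally have 2: "b * sin (s - t) = 0" by simp
    show "sin (s - t) = 0" using 1 2 ab by auto
  next
    assume s: "sin (s - t) = 0"
    have "a * cos s + b * sin s = a * cos (t + (s - t)) + b * sin (t + (s - t))" by simp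
    also have "\<dots> = (a * cos t + b * sin t) * cos (s - t)"
      unfolding cos_add sin_add using s by (simp add: algebra_simps)
    finally show "a * cos s + b * sin s = 0" using t by simp
  qed
  then have "s \<in> perp_direction v \<longleftrightarrow> (\<exists>k::int. s = t + of_int k * pi)" for s
    unfolding perp_direction_def v by (auto simp: sin_zero_iff_int2 algebra_simps)
  then show ?thesis by auto
qed

lemma direction_eq_perp_direction: "direction (a, b) = perp_direction (- b, a)"
proof -
  have "(\<exists>r. a = r * cos t \<and> b = r * sin t) \<longleftrightarrow> a * sin t = b * cos t" for t
  proof
    assume h: "a * sin t = b * cos t"
    define r where "r = a * cos t + b * sin t"
    have "r * cos t = a * (cos t)\<^sup>2 + (b * cos t) * sin t"
      by (simp add: r_def power2_eq_square algebra_simps)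
    also have "\<dots> = a * ((cos t)\<^sup>2 + (sin t)\<^sup>2)"
      unfolding h[symmetric] by (simp only: power2_eq_square distrib_left mult.assoc)
    finally have 1: "a = r * cos t" by (simp only: sin_cos_squared_add2 mult_1_right)
    have "r * sin t = (a * sin t) * cos t + b * (sin t)\<^sup>2"
      by (simp add: r_def power2_eq_square algebra_simps)
    also have "\<dots> = b * ((cos t)\<^sup>2 + (sin t)\<^sup>2)"
      unfolding h by (simp only: power2_eq_square distrib_left mult.assoc)
    finally have 2: "b = r * sin t" by (simp only: sin_cos_squared_add2 mult_1_right)
    show "\<exists>r. a = r * cos t \<and> b = r * sin t" using 1 2 by blast
  qed auto
  then show ?thesis by (auto simp: direction_def perp_direction_def)
qed

definition theta :: "(space \<Rightarrow> real) \<Rightarrow> real \<Rightarrow> plane \<Rightarrow> real set" where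
  "theta \<phi> \<alpha> x = perp_direction (slice_grad \<phi> \<alpha> x)"

definition angle_rep :: "real \<Rightarrow> real set \<Rightarrow> real" where
  "angle_rep a \<theta> = (THE t. t \<in> \<theta> \<and> a \<le> t \<and> t < a + pi)"

definition angle_monotonicity :: "(space \<Rightarrow> real) \<Rightarrow> space set \<Rightarrow> bool" where
  "angle_monotonicity \<phi> D \<longleftrightarrow>
    (\<forall>x. \<exists>a. strict_mono_on (param_set D x) (\<lambda>\<alpha>. angle_rep a (theta \<phi> \<alpha> x)))"

definition nbhd :: "real \<Rightarrow> plane set \<Rightarrow> plane set" where
  "nbhd r E = (\<Union>y\<in>E. ball y r)"

text \<open>The segment \<open>L\<close> has endpoints \<open>p \<noteq> q\<close>. Degenerate segments have no direction, and would in any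
  case impose no condition, because their neighbourhood of radius \<open>\<delta> * 0\<close> is empty.\<close>

definition rectangle_squishing :: "(space \<Rightarrow> real) \<Rightarrow> space set \<Rightarrow> bool" where
  "rectangle_squishing \<phi> D \<longleftrightarrow>
    (\<forall>D' \<epsilon>. bounded D' \<and> D' \<subseteq> D \<and> \<epsilon> > 0 \<longrightarrow>
      (\<exists>\<delta>>0. \<forall>p q \<alpha>.
        p \<noteq> q \<and> dist p q \<le> \<delta> \<and>
        (\<exists>x \<in> slice D' \<alpha> \<inter> nbhd (\<delta> * dist p q) (closed_segment p q).
           setdist (theta \<phi> \<alpha> x) (direction (q - p)) \<le> \<delta>) \<longrightarrow>
        (\<exists>c d. d - c \<le> \<epsilon> * dist p q \<and>
           (\<lambda>x. \<phi> (\<alpha>, x)) ` (nbhd (\<delta> * dist p q) (closed_segment p q) \<inter> slice D \<alpha>) \<subseteq> {c..d})))"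

definition admissible :: "(space \<Rightarrow> real) \<Rightarrow> space set \<Rightarrow> bool" where
  "admissible \<phi> D \<longleftrightarrow>
    C1_on \<phi> D \<and> non_stationary \<phi> D \<and> angle_monotonicity \<phi> D \<and> rectangle_squishing \<phi> D"

definition extends_continuously :: "space set \<Rightarrow> (space \<Rightarrow> real) \<Rightarrow> bool" where
  "extends_continuously D \<phi> \<longleftrightarrow>
    (\<exists>f. continuous_on (closure D) f \<and> (\<forall>p\<in>D. f p = \<phi> p))"

definition grad_extends_continuously_nonzero :: "space set \<Rightarrow> (space \<Rightarrow> real) \<Rightarrow> bool" where
  "grad_extends_continuously_nonzero D \<phi> \<longleftrightarrow>
    (\<exists>g. continuous_on (closure D) g \<and> (\<forall>\<alpha> x. (\<alpha>, x) \<in> D \<longrightarrow> g (\<alpha>, x) = slice_grad \<phi> \<alpha> x) \<and>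
         (\<forall>p\<in>closure D. g p \<noteq> 0))"

definition curve :: "(space \<Rightarrow> real) \<Rightarrow> space set \<Rightarrow> plane \<Rightarrow> plane set" where
  "curve \<phi> D x = {(\<alpha>, \<phi> (\<alpha>, x)) | \<alpha>. \<alpha> \<in> param_set D x}"

end

theory Submission
  imports Defs
begin

text \<open>Fix a point \<open>(\<alpha>\<^sub>0, x\<^sub>0)\<close> of \<open>D\<close>. A short segment through \<open>x\<^sub>0\<close>, transversal to the level
  line of \<open>\<phi>\<^sub>\<alpha>\<close> for \<open>\<alpha>\<close> near \<open>\<alpha>\<^sub>0\<close>, gives curves that cover a neighbourhood of
  \<open>(\<alpha>\<^sub>0, \<phi>(\<alpha>\<^sub>0, x\<^sub>0))\<close>. By angle monotonicity, for \<open>\<alpha>\<close> away from \<open>\<alpha>\<^sub>0\<close> the directions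
  \<open>\<theta>\<^sub>\<alpha>(x)\<close> stay in an arc \<open>[b, d]\<close> that avoids \<open>\<theta>\<close> at \<open>(\<alpha>\<^sub>0, x\<^sub>0)\<close>. The segment is replaced by a
  Venetian blind: its pieces are turned step by step from \<open>b\<close> to \<open>d\<close>, in steps so small that for
  each \<open>\<alpha>\<close> and \<open>x\<close> some stage has almost the direction \<open>\<theta>\<^sub>\<alpha>(x)\<close>, where the rectangle squishing
  condition makes the image under \<open>\<phi>\<^sub>\<alpha>\<close> short. Hence the curves leave a given neighbourhood only in
  a set of small measure. Iterating this for open sets that approximate \<open>F\<close> from outside gives a
  tree of nested sets of parameters; compactness along its branches yields the curves that cover
  \<open>F\<close>.\<close>

section \<open>Directions and gradients\<close>

definition dir :: "real \<Rightarrow> plane" where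
  "dir t = (cos t, sin t)"

lemma norm_dir [simp]: "norm (dir t) = 1"
  by (simp add: dir_def norm_Pair)

lemma dir_nonzero [simp]: "dir t \<noteq> 0"
  using norm_dir[of t] by fastforce

text \<open>The law of sines in a triangle with sides of directions \<open>a\<close>,
  \<open>b\<close> and \<open>c\<close>. For \<open>a \<le> b \<le> c\<close> and
  \<open>c - a < pi\<close> the coefficients are nonnegative, which is how the identity gets
  used.\<close>

lemma dir_combination:
  "sin (c - a) *\<^sub>R dir b = sin (c - b) *\<^sub>R dir a + sin (b - a) *\<^sub>R dir c"
proof -
  have "sin (c - a) * cos b = sin (c - b) * cos a + sin (b - a) * cos c"
    by (simp add: sin_diff algebra_simps)
  moreover have "sin (c - a) * sin b = sin (c - b) * sin a + sin (b - a) * sin c"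
    by (simp add: sin_diff algebra_simps)
  ultimately show ?thesis
    by (simp add: dir_def)
qed

lemma mem_perp_direction: "t \<in> perp_direction v \<longleftrightarrow> v \<bullet> dir t = 0"
  by (simp add: perp_direction_def dir_def)

lemma mem_direction_dir: "r > 0 \<Longrightarrow> t \<in> direction (r *\<^sub>R dir t)"
  by (auto simp: direction_def dir_def)

lemma perp_direction_shift:
  "t \<in> perp_direction v \<Longrightarrow> t + of_int k * pi \<in> perp_direction v"
proof (cases "v = 0")
  case True
  then show ?thesis by (simp add: mem_perp_direction)
next
  case False
  assume "t \<in> perp_direction v"
  from perp_direction_coset[OF False this] show ?thesis by blast
qed

lemma perp_direction_diff:
  assumes "v \<noteq> 0" "s \<in> perp_direction v" "t \<in> perp_direction v"
  obtains k :: int where "t = s + of_int k * pi"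
  using perp_direction_coset[OF assms(1,2)] assms(3) by auto

text \<open>\<open>v\<close> is \<open>norm v\<close> times the unit vector at angle
  \<open>s + pi / 2\<close>; this choice of \<open>s\<close> modulo \<open>2 * pi\<close> fixes the
  sign of the sine.\<close>

lemma perp_direction_nonempty:
  assumes "v \<noteq> 0"
  obtains s where "s \<in> perp_direction v" "\<And>t. v \<bullet> dir t = norm v * sin (t - s)"
proof -
  obtain a b where v: "v = (a, b)" by (cases v)
  have n: "norm v > 0" using assms by simp
  have n2: "(norm v)\<^sup>2 = a\<^sup>2 + b\<^sup>2"
    by (simp add: v norm_Pair)
  have "(b / norm v)\<^sup>2 + (- a / norm v)\<^sup>2 = 1"
  proof -
    have "(b / norm v)\<^sup>2 + (- a / norm v)\<^sup>2 = (a\<^sup>2 + b\<^sup>2) / (norm v)\<^sup>2"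
      by (simp add: power_divide add_divide_distrib)
    then show ?thesis
      using n by (simp flip: n2)
  qed
  then obtain s where s: "b / norm v = cos s" "- a / norm v = sin s"
    using sincos_total_2pi_le by metis
  then have ab: "a = - norm v * sin s" "b = norm v * cos s"
    using n by (auto simp: field_simps)
  have *: "v \<bullet> dir t = norm v * sin (t - s)" for t
  proof -
    have "v \<bullet> dir t = a * cos t + b * sin t"
      by (simp add: v dir_def)
    also have "\<dots> = (- norm v * sin s) * cos t + (norm v * cos s) * sin t"
      using ab by presburger
    finally show ?thesis
      by (simp add: sin_diff algebra_simps)
  qed
  show ?thesis
    by (rule that[OF _ *]) (simp add: mem_perp_direction *)
qed

text \<open>Here \<open>s\<close> is an arbitrary representative; a shift by an odd multiple of
  \<open>pi\<close> reverses the sine, so only the modulus of the factor is fixed.\<close>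

lemma inner_dir:
  assumes "v \<noteq> 0" "s \<in> perp_direction v"
  obtains r where "\<bar>r\<bar> = norm v" "\<And>t. v \<bullet> dir t = r * sin (t - s)"
proof -
  obtain s' where s': "s' \<in> perp_direction v" "\<And>t. v \<bullet> dir t = norm v * sin (t - s')"
    using perp_direction_nonempty[OF assms(1)] by metis
  obtain k where k: "s' = s + of_int k * pi"
    using perp_direction_diff[OF assms(1,2) s'(1)] .
  have sin0: "sin (of_int k * pi) = 0"
    using sin_times_pi_eq_0[of "of_int k"] by simp
  then have "sin (t - s') = cos (of_int k * pi) * sin (t - s)" for t
    by (simp add: k diff_diff_add[symmetric] sin_diff[of "t - s"])
  moreover have "\<bar>cos (of_int k * pi)\<bar> = 1"
    using sin0 by (simp add: abs_square_eq_1[symmetric] cos_squared_eq)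
  ultimately show ?thesis
    using that[of "norm v * cos (of_int k * pi)"] s'(2) by (simp add: abs_mult)
qed

text \<open>Justifies the definite description: a floor shifts some representative into the
  interval, and two members there differ by an integer multiple of \<open>pi\<close> smaller than
  \<open>pi\<close>.\<close>

lemma angle_rep_mem:
  assumes "v \<noteq> 0"
  shows "angle_rep a (perp_direction v) \<in> perp_direction v"
    and "a \<le> angle_rep a (perp_direction v)" and "angle_rep a (perp_direction v) < a + pi"
proof -
  let ?P = "\<lambda>t. t \<in> perp_direction v \<and> a \<le> t \<and> t < a + pi"
  obtain s where s: "s \<in> perp_direction v"
    using perp_direction_nonempty[OF assms] by metis
  obtain m :: int where m: "of_int m \<le> (s - a) / pi" "(s - a) / pi < of_int m + 1"
    using of_int_floor_le real_of_int_floor_add_one_gt by blast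
  define k where "k = - m"
  have "a \<le> s + of_int k * pi" "s + of_int k * pi < a + pi"
    using m by (simp_all add: k_def pos_le_divide_eq pos_divide_less_eq algebra_simps)
  then have ex: "?P (s + of_int k * pi)"
    using perp_direction_shift[OF s] by blast
  have "t = t'" if "?P t" "?P t'" for t t'
  proof -
    obtain j :: int where j: "t' = t + of_int j * pi"
      using perp_direction_diff[OF assms] \<open>?P t\<close> \<open>?P t'\<close> by metis
    from that have "a \<le> t" "t < a + pi" "a \<le> t'" "t' < a + pi" by auto
    then have "of_int j * pi < 1 * pi" "(-1) * pi < of_int j * pi"
      using j by linarith+
    then have "of_int j < (1::real)" "(-1::real) < of_int j"
      using mult_less_cancel_right_pos pi_gt_zero by blast+
    then have "j = 0" by linarith
    then show ?thesis using j by simp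
  qed
  then have "\<exists>!t. ?P t" using ex by blast
  then have "?P (angle_rep a (perp_direction v))"
    unfolding angle_rep_def by (rule theI')
  then show "angle_rep a (perp_direction v) \<in> perp_direction v"
    and "a \<le> angle_rep a (perp_direction v)" and "angle_rep a (perp_direction v) < a + pi"
    by auto
qed

text \<open>On an arc shorter than \<open>pi\<close>, \<open>dir t\<close> is a nonnegative
  combination of the two end directions. Positivity of the gradient on an arc thus has to be secured
  at two directions only.\<close>

lemma inner_dir_pos_between:
  assumes "v \<bullet> dir b > 0" "v \<bullet> dir c > 0" "b \<le> t" "t \<le> c" "c - b < pi"
  shows "v \<bullet> dir t > 0"
proof (cases "b = c")
  case True
  then show ?thesis using assms by auto
next
  case False
  then have pos: "sin (c - b) > 0"
    using assms by (intro sin_gt_zero) auto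
  have nn: "sin (c - t) \<ge> 0" "sin (t - b) \<ge> 0"
    using assms by (auto intro!: sin_ge_zero)
  have "sin (c - t) > 0 \<or> sin (t - b) > 0"
    using sin_gt_zero[of "c - t"] sin_gt_zero[of "t - b"] assms False by fastforce
  then have "sin (c - t) * (v \<bullet> dir b) + sin (t - b) * (v \<bullet> dir c) > 0"
    using nn assms by (meson add_nonneg_pos add_pos_nonneg less_imp_le mult_nonneg_nonneg mult_pos_pos)
  moreover have "sin (c - b) * (v \<bullet> dir t) = v \<bullet> (sin (c - b) *\<^sub>R dir t)"
    by simp
  moreover have "\<dots> = sin (c - t) * (v \<bullet> dir b) + sin (t - b) * (v \<bullet> dir c)"
    by (subst dir_combination[of c b t]) (simp add: inner_add_right)
  ultimately show ?thesis
    using pos by (metis zero_less_mult_pos)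
qed

text \<open>\<open>g0 \<bullet> dir t\<close> changes sign between \<open>s - e\<close> and
  \<open>s + e\<close>. The strict sign change survives a small change of the vector, and the
  intermediate value theorem yields a perpendicular direction in between.\<close>

lemma perp_direction_perturb:
  fixes g :: "'a::topological_space \<Rightarrow> plane"
  assumes lim: "(g \<longlongrightarrow> g0) F" and "g0 \<noteq> 0" and s: "s \<in> perp_direction g0" and e: "0 < e" "e < pi"
  shows "\<forall>\<^sub>F x in F. \<exists>s'\<in>perp_direction (g x). \<bar>s' - s\<bar> \<le> e"
proof -
  obtain r where r: "\<bar>r\<bar> = norm g0" "\<And>t. g0 \<bullet> dir t = r * sin (t - s)"
    using inner_dir[OF assms(2) s] by metis
  have "((\<lambda>x. (g x \<bullet> dir (s - e)) * (g x \<bullet> dir (s + e))) \<longlongrightarrow>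
      (g0 \<bullet> dir (s - e)) * (g0 \<bullet> dir (s + e))) F"
    by (intro tendsto_intros lim)
  moreover have "r < 0 \<or> 0 < r"
    using r(1) \<open>g0 \<noteq> 0\<close> by (metis abs_zero linorder_neqE_linordered_idom norm_eq_zero)
  then have "(g0 \<bullet> dir (s - e)) * (g0 \<bullet> dir (s + e)) < 0"
    using sin_gt_zero[OF e] by (auto simp: r(2) zero_less_mult_iff mult_less_0_iff)
  ultimately have "\<forall>\<^sub>F x in F. (g x \<bullet> dir (s - e)) * (g x \<bullet> dir (s + e)) < 0"
    by (rule order_tendstoD(2))
  then show ?thesis
  proof eventually_elim
    case (elim x)
    have cont: "continuous_on {s - e..s + e} (\<lambda>t. g x \<bullet> dir t)"
      unfolding dir_def by (intro continuous_intros)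
    have "\<exists>t. s - e \<le> t \<and> t \<le> s + e \<and> g x \<bullet> dir t = 0"
      using elim IVT'[of "\<lambda>t. g x \<bullet> dir t", OF _ _ _ cont, of 0]
        IVT2'[of "\<lambda>t. g x \<bullet> dir t", OF _ _ _ cont, of 0] e
      by (auto simp: mult_less_0_iff)
    then show ?case
      by (force simp: mem_perp_direction)
  qed
qed

section \<open>Gradients of the slices\<close>

text \<open>Uniqueness of the derivative resolves the definite description in
  \<open>slice_grad\<close>; the formula by partial derivatives transfers continuity to the
  gradient.\<close>

lemma slice_grad_has_derivative:
  assumes "C1_on \<phi> D" "(\<alpha>, x) \<in> D"
  shows "((\<lambda>y. \<phi> (\<alpha>, y)) has_derivative (\<lambda>h. h \<bullet> slice_grad \<phi> \<alpha> x)) (at x)"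
    and "slice_grad \<phi> \<alpha> x = (frechet_derivative \<phi> (at (\<alpha>, x)) (0, 1, 0), frechet_derivative \<phi> (at (\<alpha>, x)) (0, 0, 1))"
proof -
  let ?f = "frechet_derivative \<phi> (at (\<alpha>, x))"
  let ?g = "(?f (0, 1, 0), ?f (0, 0, 1))"
  have der: "(\<phi> has_derivative ?f) (at (\<alpha>, x))"
    using assms frechet_derivative_works unfolding C1_on_def differentiable_def by blast
  have "((\<lambda>y. (\<alpha>, y)) has_derivative (\<lambda>h. (0, h))) (at x)"
    by (auto intro!: derivative_eq_intros)
  from diff_chain_at[OF this der]
  have 1: "((\<lambda>y. \<phi> (\<alpha>, y)) has_derivative (\<lambda>h. ?f (0, h))) (at x)"
    by (simp add: o_def)
  have lin: "linear ?f" using der has_derivative_linear by blast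
  have "?f (0, h) = h \<bullet> ?g" for h
  proof -
    obtain a b where h: "h = (a, b)" by (cases h)
    have "(0, h) = a *\<^sub>R (0, 1, 0) + b *\<^sub>R (0::real, 0::real, 1::real)"
      by (simp add: h)
    then show ?thesis
      by (simp only: linear_add[OF lin] linear_scale[OF lin]) (simp add: h)
  qed
  then have "(\<lambda>h. ?f (0, h)) = (\<lambda>h. h \<bullet> ?g)"
    by (rule ext)
  with 1 have g: "GDERIV (\<lambda>y. \<phi> (\<alpha>, y)) x :> ?g"
    by (simp only: gderiv_def)
  have "v = ?g" if "GDERIV (\<lambda>y. \<phi> (\<alpha>, y)) x :> v" for v
  proof -
    have "(\<lambda>h. h \<bullet> v) = (\<lambda>h. h \<bullet> ?g)"
      using has_derivative_unique that g unfolding gderiv_def by blast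
    then show ?thesis
      by (metis inner_commute vector_eq_ldot)
  qed
  with g show eq: "slice_grad \<phi> \<alpha> x = ?g"
    unfolding slice_grad_def by (intro the_equality)
  show "((\<lambda>y. \<phi> (\<alpha>, y)) has_derivative (\<lambda>h. h \<bullet> slice_grad \<phi> \<alpha> x)) (at x)"
    unfolding eq using g by (simp add: gderiv_def)
qed

lemma C1_on_imp_continuous_on: "C1_on \<phi> D \<Longrightarrow> continuous_on D \<phi>"
  unfolding C1_on_def by (meson continuous_at_imp_continuous_on has_derivative_continuous)

lemma continuous_on_slice_grad:
  assumes "C1_on \<phi> D"
  shows "continuous_on D (\<lambda>p. slice_grad \<phi> (fst p) (snd p))"
proof -
  obtain \<phi>' where d: "\<And>p. p \<in> D \<Longrightarrow> (\<phi> has_derivative blinfun_apply (\<phi>' p)) (at p)"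
    and c: "continuous_on D \<phi>'"
    using assms unfolding C1_on_def by blast
  have "continuous_on D (\<lambda>p. (blinfun_apply (\<phi>' p) (0, 1, 0), blinfun_apply (\<phi>' p) (0, 0, 1)))"
    by (intro continuous_intros c)
  then show ?thesis
  proof (rule continuous_on_eq)
    fix p assume p: "p \<in> D"
    then have "frechet_derivative \<phi> (at p) = blinfun_apply (\<phi>' p)"
      using d frechet_derivative_at by metis
    then show "(blinfun_apply (\<phi>' p) (0, 1, 0), blinfun_apply (\<phi>' p) (0, 0, 1)) =
        slice_grad \<phi> (fst p) (snd p)"
      using slice_grad_has_derivative(2)[OF assms, of "fst p" "snd p"] p by simp
  qed
qed

lemma nbhdE:
  assumes "x \<in> nbhd r L"
  obtains y where "y \<in> L" "dist y x < r"
  using assms by (auto simp: nbhd_def)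

section \<open>Rectangle squishing on convex slices\<close>

text \<open>On a segment nearly along the level line the mean value theorem leaves three small
  contributions: the angular error, the thickness of the neighbourhood and the variation of the
  gradient. Convexity keeps the connecting segment in the slice; the extension to the closure gives
  uniform bounds by compactness.\<close>

lemma rectangle_squishing_if_convex_slices:
  assumes C1: "C1_on \<phi> D" and ns: "non_stationary \<phi> D"
    and ext: "grad_extends_continuously_nonzero D \<phi>"
    and conv: "\<And>\<alpha>. convex (slice D \<alpha>)"
  shows "rectangle_squishing \<phi> D"
  unfolding rectangle_squishing_def
proof (intro allI impI)
  fix D' :: "space set" and \<epsilon> :: real
  assume asm: "bounded D' \<and> D' \<subseteq> D \<and> \<epsilon> > 0"
  then have \<epsilon>: "\<epsilon> > 0" by simp
  obtain g where g: "continuous_on (closure D) g"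
    "\<And>\<alpha> x. (\<alpha>, x) \<in> D \<Longrightarrow> g (\<alpha>, x) = slice_grad \<phi> \<alpha> x"
    using ext unfolding grad_extends_continuously_nonzero_def by blast
  obtain M where M: "\<And>p. p \<in> D' \<Longrightarrow> norm p \<le> M"
    using asm bounded_iff by blast
  \<comment> \<open>The margin 3 leaves room for points at distance at most
    \<open>3 * l \<le> 3\<close> from points of \<open>D'\<close>.\<close>
  define K where "K = closure D \<inter> cball 0 (M + 3)"
  have K: "compact K" unfolding K_def by (intro closed_Int_compact) auto
  have gK: "continuous_on K g"
    using g(1) by (rule continuous_on_subset) (auto simp: K_def)
  then have "bounded (g ` K)"
    using compact_continuous_image[OF gK K] compact_imp_bounded by blast
  then obtain B where B: "B > 0" "\<And>p. p \<in> K \<Longrightarrow> norm (g p) \<le> B"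
    unfolding bounded_pos by auto
  obtain d where d: "d > 0" "\<And>p q. p \<in> K \<Longrightarrow> q \<in> K \<Longrightarrow> dist q p < d \<Longrightarrow> dist (g q) (g p) < \<epsilon> / 12"
    using compact_uniformly_continuous[OF gK K] \<epsilon>
    unfolding uniformly_continuous_on_def by (metis divide_pos_pos zero_less_numeral)
  \<comment> \<open>The bound 1 keeps these points in \<open>K\<close>, \<open>d / 4\<close> makes
    \<open>3 * l < d\<close>, and the last bound makes angular error and thickness together cost at
    most \<open>\<epsilon> / 4 * l\<close>.\<close>
  define \<delta> where "\<delta> = Min {1, d / 4, \<epsilon> / (16 * B)}"
  have \<delta>: "\<delta> > 0" "\<delta> \<le> 1" "\<delta> \<le> d / 4" "\<delta> \<le> \<epsilon> / (16 * B)"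
    using \<epsilon> B d by (auto simp: \<delta>_def)
  then have \<delta>B: "4 * B * \<delta> \<le> \<epsilon> / 4"
    using B by (simp add: field_simps)
  show "\<exists>\<delta>>0. \<forall>p q \<alpha>.
        p \<noteq> q \<and> dist p q \<le> \<delta> \<and>
        (\<exists>x \<in> slice D' \<alpha> \<inter> nbhd (\<delta> * dist p q) (closed_segment p q).
           setdist (theta \<phi> \<alpha> x) (direction (q - p)) \<le> \<delta>) \<longrightarrow>
        (\<exists>c d. d - c \<le> \<epsilon> * dist p q \<and>
           (\<lambda>x. \<phi> (\<alpha>, x)) ` (nbhd (\<delta> * dist p q) (closed_segment p q) \<inter> slice D \<alpha>) \<subseteq> {c..d})"
  proof (rule exI[of _ \<delta>], intro conjI allI impI \<open>\<delta> > 0\<close>)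
    fix p q :: plane and \<alpha>
    assume "p \<noteq> q \<and> dist p q \<le> \<delta> \<and>
        (\<exists>x \<in> slice D' \<alpha> \<inter> nbhd (\<delta> * dist p q) (closed_segment p q).
           setdist (theta \<phi> \<alpha> x) (direction (q - p)) \<le> \<delta>)"
    then obtain x where pq: "p \<noteq> q" "dist p q \<le> \<delta>" and xD': "(\<alpha>, x) \<in> D'"
      and xL: "x \<in> nbhd (\<delta> * dist p q) (closed_segment p q)"
      and sd: "setdist (theta \<phi> \<alpha> x) (direction (q - p)) \<le> \<delta>"
      by (auto simp: slice_def)
    define l where "l = dist p q"
    have l: "l > 0" "l \<le> \<delta>" "norm (q - p) = l" using pq by (auto simp: l_def dist_norm norm_minus_commute)
    have xD: "(\<alpha>, x) \<in> D" using xD' asm by auto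
    define v where "v = slice_grad \<phi> \<alpha> x"
    have gx: "g (\<alpha>, x) = v" using g(2)[OF xD] by (simp add: v_def)
    have v0: "v \<noteq> 0" using ns xD unfolding non_stationary_def v_def by blast
    have xK: "(\<alpha>, x) \<in> K" using xD closure_subset M[OF xD'] by (auto simp: K_def)
    have vB: "norm v \<le> B" using B(2)[OF xK] gx by simp
    obtain a where a: "a \<in> perp_direction v"
      using perp_direction_nonempty[OF v0] by metis
    obtain b where b: "b \<in> direction (q - p)"
    proof -
      have "perp_direction (- snd (q - p), fst (q - p)) \<noteq> {}"
        using pq perp_direction_nonempty[of "(- snd (q - p), fst (q - p))"]
        by (metis empty_iff neg_equal_0_iff_equal prod.collapse prod.inject right_minus_eq zero_prod_def)
      moreover have "direction (q - p) = perp_direction (- snd (q - p), fst (q - p))"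
        using direction_eq_perp_direction[of "fst (q - p)" "snd (q - p)"] by (simp only: prod.collapse)
      ultimately show ?thesis
        using that by blast
    qed
    \<comment> \<open>An actual pair of representatives replaces the infimum, at the price of a
      factor 2.\<close>
    obtain s t where s: "s \<in> perp_direction v" and t: "t \<in> direction (q - p)" and st: "dist s t < 2 * \<delta>"
    proof (rule setdist_ltE[of "perp_direction v" "direction (q - p)" "2 * \<delta>"])
      show "setdist (perp_direction v) (direction (q - p)) < 2 * \<delta>"
        using sd \<delta>(1) by (simp add: theta_def v_def)
    qed (use a b in auto)
    obtain r where r: "q - p = r *\<^sub>R dir t"
      using t by (auto simp: direction_def dir_def)
    have rl: "\<bar>r\<bar> = l" using l(3) by (simp add: r)
    obtain k where k: "\<bar>k\<bar> = norm v" "\<And>t. v \<bullet> dir t = k * sin (t - s)"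
      using inner_dir[OF v0 s] by metis
    have "\<bar>v \<bullet> dir t\<bar> \<le> B * (2 * \<delta>)"
      unfolding k(2) abs_mult k(1)
      using st abs_sin_x_le_abs_x[of "t - s"] vB \<open>B > 0\<close> by (intro mult_mono) (auto simp: dist_real_def)
    then have dirbound: "\<bar>v \<bullet> (q - p)\<bar> \<le> l * (B * (2 * \<delta>))"
      unfolding r using rl l by (simp add: abs_mult)
    obtain x' where x': "x' \<in> closed_segment p q" "dist x' x < \<delta> * l"
      using xL nbhdE l_def by metis
    have main: "\<bar>\<phi> (\<alpha>, y) - \<phi> (\<alpha>, x)\<bar> \<le> \<epsilon> / 2 * l"
      if y: "y \<in> nbhd (\<delta> * dist p q) (closed_segment p q)" "(\<alpha>, y) \<in> D" for y
    proof -
      obtain y' where y': "y' \<in> closed_segment p q" "dist y' y < \<delta> * l"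
        using y(1) nbhdE l_def by metis
      obtain u w where u: "x' = p + u *\<^sub>R (q - p)" "0 \<le> u" "u \<le> 1"
        and w: "y' = p + w *\<^sub>R (q - p)" "0 \<le> w" "w \<le> 1"
        using x'(1) y'(1) unfolding closed_segment_def by (auto simp: algebra_simps)
      have eq: "y - x = (w - u) *\<^sub>R (q - p) + (y - y') + (x' - x)"
        by (simp add: u w algebra_simps)
      have wu: "\<bar>w - u\<bar> \<le> 1" using u w by auto
      have ny: "norm (y - y') \<le> \<delta> * l" "norm (x' - x) \<le> \<delta> * l"
        using x' y' by (auto simp: dist_norm norm_minus_commute)
      have "norm (y - x) \<le> \<bar>w - u\<bar> * l + \<delta> * l + \<delta> * l"
        unfolding eq using ny l(3) by (intro norm_triangle_le add_mono) auto
      also have "\<dots> \<le> 1 * l + 1 * l + 1 * l"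
        using wu \<delta> l by (intro add_mono mult_right_mono) auto
      finally have nyx: "norm (y - x) \<le> 3 * l" by simp
      have "\<bar>(y - x) \<bullet> v\<bar> \<le> \<bar>((w - u) *\<^sub>R (q - p)) \<bullet> v\<bar> + \<bar>(y - y') \<bullet> v\<bar> + \<bar>(x' - x) \<bullet> v\<bar>"
        unfolding eq inner_add_left by linarith
      also have "\<dots> \<le> l * (B * (2 * \<delta>)) + \<delta> * l * B + \<delta> * l * B"
      proof (intro add_mono)
        have "\<bar>((w - u) *\<^sub>R (q - p)) \<bullet> v\<bar> = \<bar>w - u\<bar> * \<bar>v \<bullet> (q - p)\<bar>"
          by (simp add: abs_mult inner_commute)
        also have "\<dots> \<le> 1 * (l * (B * (2 * \<delta>)))"
          using wu dirbound by (intro mult_mono) auto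
        finally show "\<bar>((w - u) *\<^sub>R (q - p)) \<bullet> v\<bar> \<le> l * (B * (2 * \<delta>))" by simp
        show "\<bar>(y - y') \<bullet> v\<bar> \<le> \<delta> * l * B" "\<bar>(x' - x) \<bullet> v\<bar> \<le> \<delta> * l * B"
          using mult_nonneg_nonneg[of \<delta> l] \<delta>(1) l(1)
          by (intro order_trans[OF Cauchy_Schwarz_ineq2] mult_mono ny vB norm_ge_zero; linarith)+
      qed
      also have "\<dots> = (4 * B * \<delta>) * l" by (simp add: algebra_simps)
      also have "\<dots> \<le> \<epsilon> / 4 * l"
        using \<delta>B l by (intro mult_right_mono) auto
      finally have first: "\<bar>(y - x) \<bullet> v\<bar> \<le> \<epsilon> / 4 * l" .
      have seg: "closed_segment x y \<subseteq> slice D \<alpha>"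
        using conv[of \<alpha>] xD y(2) by (intro closed_segment_subset) (auto simp: slice_def)
      have "\<exists>z\<in>closed_segment x y. \<phi> (\<alpha>, y) - \<phi> (\<alpha>, x) = (y - x) \<bullet> slice_grad \<phi> \<alpha> z"
      proof -
        have "((\<lambda>t. \<phi> (\<alpha>, x + t *\<^sub>R (y - x))) has_derivative
            (\<lambda>h. (h *\<^sub>R (y - x)) \<bullet> slice_grad \<phi> \<alpha> (x + t *\<^sub>R (y - x)))) (at t within {0..1})"
          if "t \<in> {0..1}" for t
        proof -
          have "x + t *\<^sub>R (y - x) \<in> closed_segment x y"
            using that by (auto simp: closed_segment_def algebra_simps intro!: exI[of _ t])
          then have "(\<alpha>, x + t *\<^sub>R (y - x)) \<in> D"
            using seg by (auto simp: slice_def)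
          note der = slice_grad_has_derivative(1)[OF C1 this]
          have "((\<lambda>t. x + t *\<^sub>R (y - x)) has_derivative (\<lambda>h. h *\<^sub>R (y - x))) (at t within {0..1})"
            by (auto intro!: derivative_eq_intros)
          from has_derivative_compose[OF this der] show ?thesis .
        qed
        from mvt_simple[of 0 1, OF _ this] obtain t where "t \<in> {0<..<1}"
          "\<phi> (\<alpha>, y) - \<phi> (\<alpha>, x) = (y - x) \<bullet> slice_grad \<phi> \<alpha> (x + t *\<^sub>R (y - x))"
          by auto
        moreover from this have "x + t *\<^sub>R (y - x) \<in> closed_segment x y"
          by (auto simp: closed_segment_def algebra_simps intro!: exI[of _ t])
        ultimately show ?thesis by blast
      qed
      then obtain z where z: "z \<in> closed_segment x y"
        and mvt: "\<phi> (\<alpha>, y) - \<phi> (\<alpha>, x) = (y - x) \<bullet> slice_grad \<phi> \<alpha> z" by blast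
      have zD: "(\<alpha>, z) \<in> D" using z seg by (auto simp: slice_def)
      have zx: "norm (z - x) \<le> 3 * l"
        using segment_bound(1)[OF z] nyx by linarith
      have dzx: "dist (\<alpha>, z) (\<alpha>, x) \<le> 3 * l"
        using zx by (simp add: dist_Pair_Pair dist_norm)
      have "norm (\<alpha>, z) \<le> M + 3"
        using dzx M[OF xD'] l \<delta> norm_triangle_ineq2[of "(\<alpha>, z)" "(\<alpha>, x)"]
        by (simp add: dist_norm)
      then have zK: "(\<alpha>, z) \<in> K" using zD closure_subset by (auto simp: K_def)
      have "dist (\<alpha>, z) (\<alpha>, x) < d" using dzx l \<delta> by linarith
      then have "norm (slice_grad \<phi> \<alpha> z - v) \<le> \<epsilon> / 12"
        using d(2)[OF xK zK] g(2)[OF zD] gx by (simp add: dist_norm)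
      \<comment> \<open>Replacing the gradient at \<open>z\<close> by \<open>v\<close> costs another
        \<open>\<epsilon> / 4 * l\<close>; the sum is half of the permitted oscillation.\<close>
      then have "\<bar>(y - x) \<bullet> (slice_grad \<phi> \<alpha> z - v)\<bar> \<le> (3 * l) * (\<epsilon> / 12)"
        using nyx l by (intro order_trans[OF Cauchy_Schwarz_ineq2] mult_mono) auto
      moreover have "(3 * l) * (\<epsilon> / 12) = \<epsilon> / 4 * l" "\<epsilon> / 2 * l = \<epsilon> / 4 * l + \<epsilon> / 4 * l"
        by simp_all
      ultimately show ?thesis
        using first unfolding mvt inner_diff_right by linarith
    qed
    show "\<exists>c d. d - c \<le> \<epsilon> * dist p q \<and>
           (\<lambda>x. \<phi> (\<alpha>, x)) ` (nbhd (\<delta> * dist p q) (closed_segment p q) \<inter> slice D \<alpha>) \<subseteq> {c..d}"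
    proof (intro exI conjI)
      show "(\<phi> (\<alpha>, x) + \<epsilon> / 2 * l) - (\<phi> (\<alpha>, x) - \<epsilon> / 2 * l) \<le> \<epsilon> * dist p q"
        by (simp add: l_def)
      show "(\<lambda>x. \<phi> (\<alpha>, x)) ` (nbhd (\<delta> * dist p q) (closed_segment p q) \<inter> slice D \<alpha>)
          \<subseteq> {\<phi> (\<alpha>, x) - \<epsilon> / 2 * l..\<phi> (\<alpha>, x) + \<epsilon> / 2 * l}"
      proof (rule image_subsetI)
        fix y assume "y \<in> nbhd (\<delta> * dist p q) (closed_segment p q) \<inter> slice D \<alpha>"
        then have "\<bar>\<phi> (\<alpha>, y) - \<phi> (\<alpha>, x)\<bar> \<le> \<epsilon> / 2 * l"
          by (intro main) (auto simp: slice_def)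
        then show "\<phi> (\<alpha>, y) \<in> {\<phi> (\<alpha>, x) - \<epsilon> / 2 * l..\<phi> (\<alpha>, x) + \<epsilon> / 2 * l}"
          unfolding atLeastAtMost_iff abs_le_iff by linarith
      qed
    qed
  qed
qed

section \<open>Venetian blinds\<close>

lemma open_nbhd [simp]: "open (nbhd r L)"
  by (auto simp: nbhd_def)

lemma subset_nbhd: "r > 0 \<Longrightarrow> L \<subseteq> nbhd r L"
  by (force simp: nbhd_def)

lemma nbhd_mono: "r \<le> r' \<Longrightarrow> nbhd r L \<subseteq> nbhd r' L"
  by (force simp: nbhd_def)

lemma nbhd_subset_nbhd:
  assumes "\<And>y. y \<in> L \<Longrightarrow> \<exists>z\<in>L'. dist z y \<le> a" "a + r \<le> r'"
  shows "nbhd r L \<subseteq> nbhd r' L'"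
proof
  fix x assume "x \<in> nbhd r L"
  then obtain y where y: "y \<in> L" "dist y x < r" by (rule nbhdE)
  then obtain z where z: "z \<in> L'" "dist z y \<le> a" using assms(1) by blast
  then have "dist z x < r'"
    using y(2) assms(2) dist_triangle[of z x y] by linarith
  then show "x \<in> nbhd r' L'" using z(1) by (auto simp: nbhd_def)
qed

lemma closed_segment_ray:
  assumes "y \<in> closed_segment p (p + l *\<^sub>R u)"
  obtains t where "0 \<le> t" "t \<le> 1" "y = p + (t * l) *\<^sub>R u"
  using assms by (auto simp: closed_segment_def algebra_simps)

lemma ray_in_closed_segment:
  "0 \<le> t \<Longrightarrow> t \<le> 1 \<Longrightarrow> p + (t * l) *\<^sub>R u \<in> closed_segment p (p + l *\<^sub>R u)"
  by (auto simp: closed_segment_def algebra_simps intro!: exI[of _ t])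

text \<open>Discrete intermediate value theorem; \<open>c\<close> need not be monotone.\<close>

lemma chain_cover:
  fixes c :: "nat \<Rightarrow> real"
  assumes "c 0 \<le> t" "t \<le> c n" "n > 0"
  shows "\<exists>i<n. c i \<le> t \<and> t \<le> c (Suc i)"
  using assms
proof (induction n)
  case (Suc n)
  show ?case
  proof (cases "c n \<le> t")
    case False
    then have "n > 0" using Suc.prems by (cases n) auto
    then show ?thesis using Suc False by (meson less_SucI linorder_le_cases)
  qed (use Suc.prems in auto)
qed simp

text \<open>In the application \<open>f \<alpha> = \<phi>\<^sub>\<alpha>\<close>, \<open>S \<alpha> = D\<^sub>\<alpha>\<close> and \<open>\<Theta> \<alpha> x = \<theta>\<^sub>\<alpha>(x)\<close>. The images under \<open>f \<alpha>\<close> have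
  to stay large for \<open>\<alpha> \<in> I\<close> and to become small for \<open>\<alpha> \<in> J\<close>. The direction \<open>\<gamma>\<close>, beyond all the
  directions \<open>[b, d]\<close> used, is that of the third side of the triangles by which segments are turned.\<close>

locale venetian_blind =
  fixes f :: "real \<Rightarrow> plane \<Rightarrow> real" and S :: "real \<Rightarrow> plane set"
    and \<Theta> :: "real \<Rightarrow> plane \<Rightarrow> real set"
    and I J :: "real set" and B :: "plane set" and b d \<gamma> \<delta> \<kappa> :: real
  assumes angles: "b \<le> d" "d < \<gamma>" "\<gamma> - b < pi"
    and mono: "\<And>\<alpha> x \<psi> h. \<lbrakk>\<alpha> \<in> I; x \<in> B; b \<le> \<psi>; \<psi> \<le> \<gamma>; 0 \<le> h; x + h *\<^sub>R dir \<psi> \<in> B\<rbrakk>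
        \<Longrightarrow> f \<alpha> x \<le> f \<alpha> (x + h *\<^sub>R dir \<psi>)"
    and cont: "\<And>\<alpha>. \<alpha> \<in> I \<Longrightarrow> continuous_on B (f \<alpha>)"
    and delta: "\<delta> > 0" and kappa: "\<kappa> > 0"
    and squish: "\<And>\<alpha> \<psi> l p x s. \<lbrakk>\<alpha> \<in> J; b \<le> \<psi>; \<psi> \<le> d; 0 < l; l \<le> \<delta>;
        x \<in> S \<alpha> \<inter> B \<inter> nbhd (\<delta> * l) (closed_segment p (p + l *\<^sub>R dir \<psi>)); s \<in> \<Theta> \<alpha> x; \<bar>s - \<psi>\<bar> \<le> \<delta>\<rbrakk>
      \<Longrightarrow> \<exists>c e. e - c \<le> \<kappa> * l * sin (\<gamma> - \<psi>) \<and>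
            f \<alpha> ` (nbhd (\<delta> * l) (closed_segment p (p + l *\<^sub>R dir \<psi>)) \<inter> S \<alpha>) \<subseteq> {c..e}"
begin

text \<open>Outer measure by way of a measurable superset: for \<open>\<alpha> \<in> J\<close> no
  continuity is assumed, so the image itself need not be measurable.\<close>

definition small_shadow :: "plane set \<Rightarrow> real \<Rightarrow> real \<Rightarrow> bool" where
  "small_shadow E \<alpha> r \<longleftrightarrow> (\<exists>Z\<in>sets lborel. f \<alpha> ` (E \<inter> S \<alpha>) \<subseteq> Z \<and> emeasure lborel Z \<le> ennreal r)"

text \<open>The set \<open>E\<close> replaces the segment of direction \<open>\<psi>\<close> and length \<open>l\<close>. The lower bound \<open>\<psi>'\<close> records
  that the points with directions in \<open>[b, \<psi>')\<close> were taken care of at an earlier stage. Stopping at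
  the first suitable stage, instead of summing over the stages, keeps the bound on the shadow
  independent of their number; the weight \<open>sin (\<gamma> - \<psi>)\<close> compensates for the growth of the total
  length when segments are turned.\<close>

definition blind :: "real \<Rightarrow> real \<Rightarrow> plane \<Rightarrow> real \<Rightarrow> real \<Rightarrow> plane set \<Rightarrow> bool" where
  "blind \<psi>' \<psi> p l \<tau> E \<longleftrightarrow> open E \<and> E \<subseteq> nbhd \<tau> (closed_segment p (p + l *\<^sub>R dir \<psi>)) \<and>
    (\<forall>\<alpha>\<in>I. {f \<alpha> p..f \<alpha> (p + l *\<^sub>R dir \<psi>)} \<subseteq> f \<alpha> ` E) \<and>
    (\<forall>\<alpha>\<in>J. (\<forall>x\<in>E \<inter> S \<alpha>. \<exists>s\<in>\<Theta> \<alpha> x. \<psi>' \<le> s \<and> s \<le> d) \<longrightarrow> small_shadow E \<alpha> (\<kappa> * l * sin (\<gamma> - \<psi>)))"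

lemma sin_pos: "b \<le> \<psi> \<Longrightarrow> \<psi> \<le> d \<Longrightarrow> sin (\<gamma> - \<psi>) > 0"
  using angles by (intro sin_gt_zero) auto

text \<open>The segment is cut into \<open>N\<close> pieces, and each is replaced by one of
  direction \<open>\<psi>'\<close> with the same starting point, ending on the ray of direction
  \<open>\<gamma>\<close> from the end of the old piece. For \<open>\<alpha> \<in> I\<close> the
  function \<open>f \<alpha>\<close> is nondecreasing along this ray, so nothing of the image is
  lost. The total length changes by a ratio of sines, which the weight
  \<open>sin (\<gamma> - \<psi>)\<close> cancels.\<close>

lemma split_segment:
  assumes \<psi>: "b \<le> \<psi>" "\<psi> \<le> \<psi>'" "\<psi>' \<le> d" and l: "l > 0" and \<tau>: "\<tau> > 0"
    and sub: "nbhd \<tau> (closed_segment p (p + l *\<^sub>R dir \<psi>)) \<subseteq> B"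
    and pieces: "\<And>p m \<tau>. \<lbrakk>0 < m; m \<le> \<delta>; 0 < \<tau>; nbhd \<tau> (closed_segment p (p + m *\<^sub>R dir \<psi>')) \<subseteq> B\<rbrakk>
      \<Longrightarrow> \<exists>E. blind \<psi>' \<psi>' p m \<tau> E"
  shows "\<exists>E. blind \<psi>' \<psi> p l \<tau> E"
proof -
  let ?L = "closed_segment p (p + l *\<^sub>R dir \<psi>)"
  have s': "sin (\<gamma> - \<psi>') > 0" and s: "sin (\<gamma> - \<psi>) > 0"
    using sin_pos \<psi> by auto
  have sd: "sin (\<psi>' - \<psi>) \<ge> 0"
    using \<psi> angles by (intro sin_ge_zero) auto
  define R where "R = sin (\<gamma> - \<psi>) / sin (\<gamma> - \<psi>')"
  have R: "R > 0" using s s' by (simp add: R_def)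
  \<comment> \<open>Half of \<open>\<tau>\<close> is spent on the length of the turned pieces, the
    other half on the neighbourhoods around them.\<close>
  define c where "c = min \<delta> (\<tau> / 2)"
  have c: "c > 0" "c \<le> \<delta>" "c \<le> \<tau> / 2" using delta \<tau> by (auto simp: c_def)
  define N :: nat where "N = Suc (nat \<lceil>l * R / c\<rceil>)"
  have N: "N > 0" by (simp add: N_def)
  have "l * R / c \<le> real N"
    unfolding N_def by linarith
  then have NR: "l * R / N \<le> c"
    using c N by (simp add: pos_divide_le_eq mult.commute)
  define m where "m = l / N * R"
  have "m = l * R / N" by (simp add: m_def)
  then have m: "m > 0" "m \<le> \<delta>" "m \<le> \<tau> / 2"
    using l R N NR c by (simp, linarith+)
  define P where "P i = p + (real i / N * l) *\<^sub>R dir \<psi>" for i :: nat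
  have PL: "P i \<in> ?L" if "i \<le> N" for i
    unfolding P_def using that N by (intro ray_in_closed_segment) auto
  have P_end: "P 0 = p" "P N = p + l *\<^sub>R dir \<psi>"
    using N by (auto simp: P_def)
  \<comment> \<open>law of sines in the triangle with sides of directions \<open>\<psi>\<close>, \<open>\<psi>'\<close> and \<open>\<gamma>\<close>\<close>
  have P_Suc: "P (Suc i) = P i + (l / N) *\<^sub>R dir \<psi>" for i
    by (simp add: P_def add_divide_distrib distrib_right scaleR_left_distrib)
  have tri: "P i + m *\<^sub>R dir \<psi>' = P (Suc i) + (l / N * (sin (\<psi>' - \<psi>) / sin (\<gamma> - \<psi>'))) *\<^sub>R dir \<gamma>" for i
  proof -
    have "m *\<^sub>R dir \<psi>' = (l / N / sin (\<gamma> - \<psi>')) *\<^sub>R (sin (\<gamma> - \<psi>) *\<^sub>R dir \<psi>')"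
      by (simp add: m_def R_def)
    also have "\<dots> = (l / N) *\<^sub>R dir \<psi> + (l / N * (sin (\<psi>' - \<psi>) / sin (\<gamma> - \<psi>'))) *\<^sub>R dir \<gamma>"
      using s' by (simp add: dir_combination[of \<gamma> \<psi> \<psi>'] scaleR_right_distrib)
    finally show ?thesis
      unfolding P_Suc by (simp only: add.assoc)
  qed
  have nb: "nbhd (\<tau> / 2) (closed_segment (P i) (P i + m *\<^sub>R dir \<psi>')) \<subseteq> nbhd \<tau> ?L" if "i < N" for i
  proof (rule nbhd_subset_nbhd[of _ _ m])
    fix y assume "y \<in> closed_segment (P i) (P i + m *\<^sub>R dir \<psi>')"
    then obtain t where t: "0 \<le> t" "t \<le> 1" "y = P i + (t * m) *\<^sub>R dir \<psi>'"
      by (rule closed_segment_ray)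
    then have "dist (P i) y \<le> m"
      using m mult_right_mono[of t 1 m] by (simp add: dist_norm abs_mult)
    then show "\<exists>z\<in>?L. dist z y \<le> m" using PL[of i] that by auto
  qed (use m in simp)
  have "\<forall>i\<in>{..<N}. \<exists>E. blind \<psi>' \<psi>' (P i) m (\<tau> / 2) E"
    using nb sub m \<tau> by (intro ballI pieces) auto
  then obtain E where "\<forall>i\<in>{..<N}. blind \<psi>' \<psi>' (P i) m (\<tau> / 2) (E i)"
    using bchoice by metis
  then have E: "blind \<psi>' \<psi>' (P i) m (\<tau> / 2) (E i)" if "i < N" for i
    using that by simp
  have "blind \<psi>' \<psi> p l \<tau> (\<Union>i<N. E i)"
    unfolding blind_def
  proof (intro conjI ballI impI)
    show "open (\<Union>i<N. E i)" using E by (auto simp: blind_def)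
    show "(\<Union>i<N. E i) \<subseteq> nbhd \<tau> ?L"
    proof (rule UN_least)
      fix i assume "i \<in> {..<N}"
      then show "E i \<subseteq> nbhd \<tau> ?L" using E[of i] nb[of i] unfolding blind_def by blast
    qed
  next
    fix \<alpha> assume \<alpha>: "\<alpha> \<in> I"
    show "{f \<alpha> p..f \<alpha> (p + l *\<^sub>R dir \<psi>)} \<subseteq> f \<alpha> ` (\<Union>i<N. E i)"
    proof
      fix t assume "t \<in> {f \<alpha> p..f \<alpha> (p + l *\<^sub>R dir \<psi>)}"
      then have "\<exists>i<N. f \<alpha> (P i) \<le> t \<and> t \<le> f \<alpha> (P (Suc i))"
        using N by (intro chain_cover) (auto simp: P_end)
      then obtain i where i: "i < N" "f \<alpha> (P i) \<le> t" "t \<le> f \<alpha> (P (Suc i))" by blast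
      have inB: "P (Suc i) \<in> B"
        using PL[of "Suc i"] i(1) subset_nbhd[OF \<tau>] sub by auto
      have "P i + m *\<^sub>R dir \<psi>' \<in> nbhd \<tau> ?L"
        using nb[OF i(1)] subset_nbhd[of "\<tau> / 2"] \<tau>
        by (meson ends_in_segment(2) half_gt_zero subsetD)
      then have "f \<alpha> (P (Suc i)) \<le> f \<alpha> (P i + m *\<^sub>R dir \<psi>')"
        unfolding tri using \<alpha> inB sub l s' sd angles by (intro mono) auto
      then have "t \<in> f \<alpha> ` E i"
        using E[OF i(1)] i \<alpha> unfolding blind_def by (meson atLeastAtMost_iff order_trans subsetD)
      then show "t \<in> f \<alpha> ` (\<Union>i<N. E i)" using i(1) by auto
    qed
  next
    fix \<alpha> assume \<alpha>: "\<alpha> \<in> J"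
      and *: "\<forall>x\<in>(\<Union>i<N. E i) \<inter> S \<alpha>. \<exists>s\<in>\<Theta> \<alpha> x. \<psi>' \<le> s \<and> s \<le> d"
    have "\<forall>i\<in>{..<N}. \<exists>Z. Z \<in> sets lborel \<and> f \<alpha> ` (E i \<inter> S \<alpha>) \<subseteq> Z \<and>
        emeasure lborel Z \<le> ennreal (\<kappa> * m * sin (\<gamma> - \<psi>'))"
    proof
      fix i assume i: "i \<in> {..<N}"
      then have "\<forall>x\<in>E i \<inter> S \<alpha>. \<exists>s\<in>\<Theta> \<alpha> x. \<psi>' \<le> s \<and> s \<le> d" using * by blast
      then have "small_shadow (E i) \<alpha> (\<kappa> * m * sin (\<gamma> - \<psi>'))"
        using E[of i] \<alpha> i unfolding blind_def by blast
      then show "\<exists>Z. Z \<in> sets lborel \<and> f \<alpha> ` (E i \<inter> S \<alpha>) \<subseteq> Z \<and>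
          emeasure lborel Z \<le> ennreal (\<kappa> * m * sin (\<gamma> - \<psi>'))"
        unfolding small_shadow_def by blast
    qed
    from bchoice[OF this] obtain Z where Z: "\<And>i. i < N \<Longrightarrow> Z i \<in> sets lborel"
      "\<And>i. i < N \<Longrightarrow> f \<alpha> ` (E i \<inter> S \<alpha>) \<subseteq> Z i"
      "\<And>i. i < N \<Longrightarrow> emeasure lborel (Z i) \<le> ennreal (\<kappa> * m * sin (\<gamma> - \<psi>'))"
      by auto
    have "emeasure lborel (\<Union>i<N. Z i) \<le> (\<Sum>i<N. emeasure lborel (Z i))"
      using Z(1) by (intro emeasure_subadditive_finite) auto
    also have "\<dots> \<le> (\<Sum>i<N. ennreal (\<kappa> * m * sin (\<gamma> - \<psi>')))"
      using Z(3) by (intro sum_mono) auto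
    also have "\<dots> = ennreal (\<Sum>i<N. \<kappa> * m * sin (\<gamma> - \<psi>'))"
      using kappa m s' by (intro sum_ennreal) auto
    \<comment> \<open>Turning preserves weighted length: \<open>N * m * sin (\<gamma> - \<psi>') = l
      * sin (\<gamma> - \<psi>)\<close>.\<close>
    also have "(\<Sum>i<N. \<kappa> * m * sin (\<gamma> - \<psi>')) = \<kappa> * l * sin (\<gamma> - \<psi>)"
      using N s' by (simp add: m_def R_def)
    finally show "small_shadow (\<Union>i<N. E i) \<alpha> (\<kappa> * l * sin (\<gamma> - \<psi>))"
      unfolding small_shadow_def using Z(1,2)
      by (intro bexI[of _ "\<Union>i<N. Z i"] conjI) (fastforce, auto)
  qed
  then show ?thesis by blast
qed

text \<open>A single point of \<open>E\<close> with direction close to \<open>\<psi>\<close>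
  suffices, since squishing bounds the image of the entire neighbourhood of the segment.\<close>

lemma small_shadow_if_squished:
  assumes "\<alpha> \<in> J" "b \<le> \<psi>" "\<psi> \<le> d" "0 < l" "l \<le> \<delta>"
    and E: "E \<subseteq> nbhd (\<delta> * l) (closed_segment p (p + l *\<^sub>R dir \<psi>))" "E \<subseteq> B"
    and x: "x \<in> E \<inter> S \<alpha>" "s \<in> \<Theta> \<alpha> x" "\<bar>s - \<psi>\<bar> \<le> \<delta>"
  shows "small_shadow E \<alpha> (\<kappa> * l * sin (\<gamma> - \<psi>))"
proof -
  have "\<exists>c e. e - c \<le> \<kappa> * l * sin (\<gamma> - \<psi>) \<and>
            f \<alpha> ` (nbhd (\<delta> * l) (closed_segment p (p + l *\<^sub>R dir \<psi>)) \<inter> S \<alpha>) \<subseteq> {c..e}"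
    using E x by (intro squish[OF assms(1-5) _ x(2,3)]) auto
  then obtain c e where ce: "e - c \<le> \<kappa> * l * sin (\<gamma> - \<psi>)"
    "f \<alpha> ` (nbhd (\<delta> * l) (closed_segment p (p + l *\<^sub>R dir \<psi>)) \<inter> S \<alpha>) \<subseteq> {c..e}" by blast
  have "emeasure lborel {c..e} \<le> ennreal (\<kappa> * l * sin (\<gamma> - \<psi>))"
    using ce(1) by (cases "c \<le> e") (auto intro: ennreal_leI)
  moreover have "f \<alpha> ` (E \<inter> S \<alpha>) \<subseteq> {c..e}" using ce(2) E(1) by blast
  ultimately show ?thesis unfolding small_shadow_def by (intro bexI[of _ "{c..e}"]) auto
qed

text \<open>Induction on the number of steps of size \<open>\<delta>\<close> from
  \<open>\<psi>\<close> up to \<open>d\<close>. One set \<open>E\<close> serves all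
  \<open>\<alpha>\<close>, but the case distinction is made for each \<open>\<alpha>\<close>
  separately: either some point has direction within \<open>\<delta>\<close> of
  \<open>\<psi>\<close> and everything is squished at this stage, or all directions lie beyond
  \<open>\<psi>'\<close> and the later stages apply.\<close>

lemma blind_short_segment:
  assumes "b \<le> \<psi>" "\<psi> \<le> d" "d - \<psi> \<le> real n * \<delta>" "0 < l" "l \<le> \<delta>" "0 < \<tau>"
    and "nbhd \<tau> (closed_segment p (p + l *\<^sub>R dir \<psi>)) \<subseteq> B"
  shows "\<exists>E. blind \<psi> \<psi> p l \<tau> E"
  using assms
proof (induction n arbitrary: \<psi> p l \<tau>)
  case 0
  let ?L = "closed_segment p (p + l *\<^sub>R dir \<psi>)"
  \<comment> \<open>With no steps left \<open>\<psi> = d\<close>, so every direction still to be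
    treated equals \<open>\<psi>\<close> and a plain neighbourhood of the segment does.\<close>
  define E where "E = nbhd (min \<tau> (\<delta> * l)) ?L"
  have E: "E \<subseteq> nbhd \<tau> ?L" "E \<subseteq> nbhd (\<delta> * l) ?L"
    unfolding E_def by (auto intro!: nbhd_mono)
  then have EB: "E \<subseteq> B" using 0 by auto
  have "min \<tau> (\<delta> * l) > 0" using 0 delta by auto
  then have LE: "?L \<subseteq> E" unfolding E_def by (rule subset_nbhd)
  have "blind \<psi> \<psi> p l \<tau> E"
    unfolding blind_def
  proof (intro conjI ballI impI E(1))
    show "open E" by (simp add: E_def)
  next
    fix \<alpha> assume \<alpha>: "\<alpha> \<in> I"
    have "connected (f \<alpha> ` ?L)"
      using continuous_on_subset[OF cont[OF \<alpha>]] LE EB by (intro connected_continuous_image) auto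
    then have "{f \<alpha> p..f \<alpha> (p + l *\<^sub>R dir \<psi>)} \<subseteq> f \<alpha> ` ?L"
      by (intro connected_contains_Icc) auto
    then show "{f \<alpha> p..f \<alpha> (p + l *\<^sub>R dir \<psi>)} \<subseteq> f \<alpha> ` E" using LE by blast
  next
    fix \<alpha> assume \<alpha>: "\<alpha> \<in> J" and *: "\<forall>x\<in>E \<inter> S \<alpha>. \<exists>s\<in>\<Theta> \<alpha> x. \<psi> \<le> s \<and> s \<le> d"
    show "small_shadow E \<alpha> (\<kappa> * l * sin (\<gamma> - \<psi>))"
    proof (cases "E \<inter> S \<alpha> = {}")
      case True
      then show ?thesis unfolding small_shadow_def by (intro bexI[of _ "{}"]) auto
    next
      case False
      then obtain x s where x: "x \<in> E \<inter> S \<alpha>" "s \<in> \<Theta> \<alpha> x" "\<psi> \<le> s" "s \<le> d" using * by blast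
      then have "\<bar>s - \<psi>\<bar> \<le> \<delta>" using 0 delta by auto
      with \<alpha> E(2) EB x(1,2) 0 show ?thesis by (intro small_shadow_if_squished)
    qed
  qed
  then show ?case by blast
next
  case (Suc n)
  let ?L = "closed_segment p (p + l *\<^sub>R dir \<psi>)"
  define \<psi>' where "\<psi>' = min (\<psi> + \<delta>) d"
  \<comment> \<open>Confining the turned pieces to the \<open>\<delta> * l\<close>-neighbourhood of
    the unturned segment keeps squishing at this stage available.\<close>
  define \<tau>' where "\<tau>' = min \<tau> (\<delta> * l)"
  have \<psi>': "\<psi> \<le> \<psi>'" "\<psi>' \<le> d" "d - \<psi>' \<le> real n * \<delta>"
    using Suc.prems delta by (auto simp: \<psi>'_def algebra_simps min_def)
  have \<tau>': "\<tau>' > 0" "nbhd \<tau>' ?L \<subseteq> nbhd \<tau> ?L" "nbhd \<tau>' ?L \<subseteq> nbhd (\<delta> * l) ?L"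
    using Suc.prems delta by (auto simp: \<tau>'_def intro!: nbhd_mono)
  have "\<exists>E. blind \<psi>' \<psi> p l \<tau>' E"
  proof (rule split_segment)
    fix q m \<rho> assume "0 < m" "m \<le> \<delta>" "0 < \<rho>" "nbhd \<rho> (closed_segment q (q + m *\<^sub>R dir \<psi>')) \<subseteq> B"
    then show "\<exists>E. blind \<psi>' \<psi>' q m \<rho> E"
      using \<psi>' Suc.prems by (intro Suc.IH) auto
  qed (use \<psi>' \<tau>' Suc.prems in auto)
  then obtain E where E: "blind \<psi>' \<psi> p l \<tau>' E" by blast
  have "blind \<psi> \<psi> p l \<tau> E"
    unfolding blind_def
  proof (intro conjI ballI impI)
    show "open E" "E \<subseteq> nbhd \<tau> ?L" using E \<tau>' unfolding blind_def by blast+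
  next
    fix \<alpha> assume "\<alpha> \<in> I"
    then show "{f \<alpha> p..f \<alpha> (p + l *\<^sub>R dir \<psi>)} \<subseteq> f \<alpha> ` E" using E unfolding blind_def by blast
  next
    fix \<alpha> assume \<alpha>: "\<alpha> \<in> J" and *: "\<forall>x\<in>E \<inter> S \<alpha>. \<exists>s\<in>\<Theta> \<alpha> x. \<psi> \<le> s \<and> s \<le> d"
    show "small_shadow E \<alpha> (\<kappa> * l * sin (\<gamma> - \<psi>))"
    proof (cases "\<exists>x\<in>E \<inter> S \<alpha>. \<exists>s\<in>\<Theta> \<alpha> x. \<bar>s - \<psi>\<bar> \<le> \<delta>")
      case True
      then obtain x s where x: "x \<in> E \<inter> S \<alpha>" "s \<in> \<Theta> \<alpha> x" "\<bar>s - \<psi>\<bar> \<le> \<delta>" by blast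
      have "E \<subseteq> nbhd (\<delta> * l) ?L" "E \<subseteq> B"
        using E \<tau>' Suc.prems unfolding blind_def by blast+
      with \<alpha> x Suc.prems show ?thesis by (intro small_shadow_if_squished)
    next
      case False
      have "\<exists>s\<in>\<Theta> \<alpha> x. \<psi>' \<le> s \<and> s \<le> d" if x: "x \<in> E \<inter> S \<alpha>" for x
      proof -
        obtain s where s: "s \<in> \<Theta> \<alpha> x" "\<psi> \<le> s" "s \<le> d" using * x by blast
        then have "\<not> \<bar>s - \<psi>\<bar> \<le> \<delta>" using False x by blast
        then have "\<psi>' \<le> s" using s by (auto simp: \<psi>'_def)
        then show ?thesis using s by blast
      qed
      then show ?thesis using E \<alpha> unfolding blind_def by blast
    qed
  qed
  then show ?case by blast
qed

text \<open>A first splitting from \<open>b\<close> to \<open>b\<close>, without turning, reduces an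
  arbitrary length to pieces of length at most \<open>\<delta>\<close>.\<close>

lemma blind_exists:
  assumes "0 < l" "0 < \<tau>" and "nbhd \<tau> (closed_segment p (p + l *\<^sub>R dir b)) \<subseteq> B"
  shows "\<exists>E. blind b b p l \<tau> E"
proof -
  obtain n :: nat where "(d - b) / \<delta> \<le> real n" using real_arch_simple by blast
  then have "d - b \<le> real n * \<delta>" using delta by (simp add: pos_divide_le_eq)
  then have "\<exists>E. blind b b q m \<rho> E"
    if "0 < m" "m \<le> \<delta>" "0 < \<rho>" "nbhd \<rho> (closed_segment q (q + m *\<^sub>R dir b)) \<subseteq> B" for q m \<rho>
    using blind_short_segment[of b n m \<rho> q] that angles by simp
  then show ?thesis
    using split_segment[of b b l \<tau> p] assms angles by simp
qed

end

section \<open>Covering near a point\<close>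

lemma open_contains_box:
  fixes a :: "'a::metric_space" and x :: "'b::metric_space"
  assumes "open W" "(a, x) \<in> W"
  obtains r where "r > 0" "cball a r \<times> cball x r \<subseteq> W"
proof -
  obtain A B where AB: "open A" "open B" "(a, x) \<in> A \<times> B" "A \<times> B \<subseteq> W"
    using open_prod_elim[OF assms] by blast
  then obtain r1 r2 where "r1 > 0" "cball a r1 \<subseteq> A" "r2 > 0" "cball x r2 \<subseteq> B"
    by (metis SigmaD1 SigmaD2 open_contains_cball)
  with AB(4) show ?thesis
    by (intro that[of "min r1 r2"]) (auto simp: subset_iff)
qed

text \<open>As \<alpha> increases the direction turns monotonically by less than one period
  \<open>pi\<close>, so parameters outside \<open>[\<alpha>1, \<alpha>2]\<close> have directions on
  the complementary arc. The base point \<open>a\<close> of the representatives depends on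
  \<open>x\<close>, hence the formulation by given \<open>s1\<close> and \<open>s2\<close>.\<close>

lemma angle_outside_arc:
  assumes ns: "non_stationary \<phi> D" and am: "angle_monotonicity \<phi> D"
    and D: "(\<alpha>1, x) \<in> D" "(\<alpha>2, x) \<in> D" "(\<alpha>, x) \<in> D" and \<alpha>: "\<alpha>1 < \<alpha>2" "\<alpha> < \<alpha>1 \<or> \<alpha>2 < \<alpha>"
    and s1: "s1 \<in> theta \<phi> \<alpha>1 x" and s2: "s2 \<in> theta \<phi> \<alpha>2 x" and s: "s1 < s2" "s2 < s1 + pi"
  shows "\<exists>s\<in>theta \<phi> \<alpha> x. s2 < s \<and> s < s1 + pi"
proof -
  obtain a where a: "strict_mono_on (param_set D x) (\<lambda>\<alpha>. angle_rep a (theta \<phi> \<alpha> x))"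
    using am unfolding angle_monotonicity_def by blast
  let ?t = "\<lambda>\<alpha>. angle_rep a (theta \<phi> \<alpha> x)"
  have nz: "slice_grad \<phi> \<beta> x \<noteq> 0" if "(\<beta>, x) \<in> D" for \<beta>
    using ns that unfolding non_stationary_def by blast
  have rep: "?t \<beta> \<in> theta \<phi> \<beta> x" "a \<le> ?t \<beta>" "?t \<beta> < a + pi" if "(\<beta>, x) \<in> D" for \<beta>
    using angle_rep_mem[OF nz[OF that]] by (auto simp: theta_def)
  have mono: "?t \<beta> < ?t \<beta>'" if "(\<beta>, x) \<in> D" "(\<beta>', x) \<in> D" "\<beta> < \<beta>'" for \<beta> \<beta>'
    using a that unfolding strict_mono_on_def param_set_def by blast
  obtain k where k: "?t \<alpha>1 = s1 + of_int k * pi"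
    using perp_direction_diff[OF nz[OF D(1)]] s1 rep(1)[OF D(1)] by (metis theta_def)
  obtain m where m: "?t \<alpha>2 = s2 + of_int m * pi"
    using perp_direction_diff[OF nz[OF D(2)]] s2 rep(1)[OF D(2)] by (metis theta_def)
  \<comment> \<open>Both \<open>s2 - s1\<close> and the difference of the two representatives lie in
    \<open>(0, pi)\<close>, so the shifts by \<open>k\<close> and \<open>m\<close> agree.\<close>
  have "of_int (m - k) * pi < 1 * pi" "(-1) * pi < of_int (m - k) * pi"
    using k m s mono[OF D(1,2) \<alpha>(1)] rep(2,3)[OF D(1)] rep(2,3)[OF D(2)]
    unfolding of_int_diff left_diff_distrib by linarith+
  then have "of_int (m - k) < (1::real)" "(-1::real) < of_int (m - k)"
    using mult_less_cancel_right_pos pi_gt_zero by blast+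
  then have mk: "m = k" by linarith
  from \<alpha>(2) show ?thesis
  proof
    \<comment> \<open>Here the direction lies below \<open>s1\<close>; adding the period
      \<open>pi\<close> brings it past \<open>s2\<close>, because all representatives fit into one
      period.\<close>
    assume "\<alpha> < \<alpha>1"
    then have "?t \<alpha> < ?t \<alpha>1" using mono D by blast
    moreover have "?t \<alpha> + of_int (1 - k) * pi \<in> theta \<phi> \<alpha> x"
      using rep(1)[OF D(3)] perp_direction_shift unfolding theta_def by blast
    moreover have "of_int (1 - k) * pi = pi - of_int k * pi" by (simp add: algebra_simps)
    ultimately show ?thesis
      using k m mk rep(2,3)[OF D(3)] rep(3)[OF D(2)] by (intro bexI) auto
  next
    assume "\<alpha>2 < \<alpha>"
    then have "?t \<alpha>2 < ?t \<alpha>" using mono D by blast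
    moreover have "?t \<alpha> + of_int (- k) * pi \<in> theta \<phi> \<alpha> x"
      using rep(1)[OF D(3)] perp_direction_shift unfolding theta_def by blast
    ultimately show ?thesis
      using k m mk rep(2,3)[OF D(3)] rep(2)[OF D(1)] by (intro bexI) auto
  qed
qed

text \<open>Angle monotonicity holds for each \<open>x\<close> separately. Control uniform in
  \<open>x\<close> comes from the two parameters \<open>\<alpha>0 - r\<close> and
  \<open>\<alpha>0 + r\<close>: their directions vary continuously with \<open>x\<close>, and the
  circular order at each \<open>x\<close> confines the directions of all parameters beyond them to
  the same arc \<open>[b, d]\<close>.\<close>

lemma local_directions:
  assumes D: "open D" and C1: "C1_on \<phi> D" and ns: "non_stationary \<phi> D"
    and am: "angle_monotonicity \<phi> D"
    and p0: "(\<alpha>0, x0) \<in> D" and U: "open U" "(\<alpha>0, \<phi> (\<alpha>0, x0)) \<in> U" and N: "open N" "x0 \<in> N"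
  obtains r' r \<rho> b d \<gamma> where "0 < r'" "r' \<le> r" "0 < \<rho>"
    "b \<le> d" "d < \<gamma>" "\<gamma> - b < pi"
    "cball x0 \<rho> \<subseteq> N" "cball \<alpha>0 r \<times> cball x0 \<rho> \<subseteq> D"
    "\<And>\<alpha> x. \<alpha> \<in> cball \<alpha>0 r \<Longrightarrow> x \<in> cball x0 \<rho> \<Longrightarrow> (\<alpha>, \<phi> (\<alpha>, x)) \<in> U"
    "\<And>\<alpha> x \<psi>. \<lbrakk>\<alpha> \<in> cball \<alpha>0 r'; x \<in> cball x0 \<rho>; b \<le> \<psi>; \<psi> \<le> \<gamma>\<rbrakk> \<Longrightarrow> slice_grad \<phi> \<alpha> x \<bullet> dir \<psi> > 0"
    "\<And>\<alpha> x. \<lbrakk>\<alpha> \<notin> cball \<alpha>0 r; x \<in> cball x0 \<rho>; (\<alpha>, x) \<in> D\<rbrakk> \<Longrightarrow> \<exists>s\<in>theta \<phi> \<alpha> x. b \<le> s \<and> s \<le> d"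
proof -
  have nz: "slice_grad \<phi> \<alpha> x \<noteq> 0" if "(\<alpha>, x) \<in> D" for \<alpha> x
    using ns that unfolding non_stationary_def by blast
  define G where "G p = slice_grad \<phi> (fst p) (snd p)" for p
  have "continuous_on D G"
    using continuous_on_slice_grad[OF C1] by (simp add: G_def[abs_def])
  then have G: "(G \<longlongrightarrow> G p) (nhds p)" if "p \<in> D" for p
    using D that by (simp add: continuous_on_eq_continuous_at isCont_def tendsto_at_iff_tendsto_nhds)
  have "continuous_on D (\<lambda>p. (fst p, \<phi> p))"
    by (intro continuous_intros C1_on_imp_continuous_on[OF C1])
  then have "open (D \<inter> (\<lambda>p. (fst p, \<phi> p)) -` U)"
    using D U(1) by (rule continuous_open_preimage)
  then have "open (D \<inter> (\<lambda>p. (fst p, \<phi> p)) -` U \<inter> (UNIV \<times> N))"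
    using open_Int open_Times[OF open_UNIV N(1)] by blast
  then obtain r where r: "r > 0" "cball \<alpha>0 r \<times> cball x0 r \<subseteq> D \<inter> (\<lambda>p. (fst p, \<phi> p)) -` U \<inter> (UNIV \<times> N)"
    using p0 U N by (elim open_contains_box[of _ \<alpha>0 x0]) auto
  define \<alpha>1 \<alpha>2 where "\<alpha>1 = \<alpha>0 - r" and "\<alpha>2 = \<alpha>0 + r"
  have box: "\<alpha>1 < \<alpha>0" "\<alpha>0 < \<alpha>2" "\<alpha>1 < \<alpha>2" "\<alpha>1 \<in> cball \<alpha>0 r" "\<alpha>2 \<in> cball \<alpha>0 r"
    using r(1) by (auto simp: \<alpha>1_def \<alpha>2_def dist_real_def)
  have D12: "(\<alpha>1, x) \<in> D" "(\<alpha>2, x) \<in> D" if "x \<in> cball x0 r" for x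
    using r(2) box that by auto
  obtain s0 where s0: "s0 \<in> theta \<phi> \<alpha>0 x0" "\<And>t. slice_grad \<phi> \<alpha>0 x0 \<bullet> dir t = norm (slice_grad \<phi> \<alpha>0 x0) * sin (t - s0)"
    using perp_direction_nonempty[OF nz[OF p0]] by (metis theta_def)
  obtain a where a: "strict_mono_on (param_set D x0) (\<lambda>\<alpha>. angle_rep a (theta \<phi> \<alpha> x0))"
    using am unfolding angle_monotonicity_def by blast
  let ?t = "\<lambda>\<alpha>. angle_rep a (theta \<phi> \<alpha> x0)"
  have rep: "?t \<beta> \<in> theta \<phi> \<beta> x0" "a \<le> ?t \<beta>" "?t \<beta> < a + pi" if "(\<beta>, x0) \<in> D" for \<beta>
    using angle_rep_mem[OF nz[OF that]] by (auto simp: theta_def)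
  have mono: "?t \<beta> < ?t \<beta>'" if "(\<beta>, x0) \<in> D" "(\<beta>', x0) \<in> D" "\<beta> < \<beta>'" for \<beta> \<beta>'
    using a that unfolding strict_mono_on_def param_set_def by blast
  have D0: "(\<alpha>1, x0) \<in> D" "(\<alpha>2, x0) \<in> D" using D12 r(1) by auto
  obtain k where k: "s0 = ?t \<alpha>0 + of_int k * pi"
    using perp_direction_diff[OF nz[OF p0]] s0(1) rep(1)[OF p0] by (metis theta_def)
  \<comment> \<open>The shift by the same \<open>k\<close> as for \<open>s0\<close> preserves the
    order; \<open>s0\<close> is normalised so that the gradient at the base point is positive on
    directions in \<open>(s0, s0 + pi)\<close>.\<close>
  define s1 s2 where "s1 = ?t \<alpha>1 + of_int k * pi" and "s2 = ?t \<alpha>2 + of_int k * pi"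
  have s12: "s1 \<in> theta \<phi> \<alpha>1 x0" "s2 \<in> theta \<phi> \<alpha>2 x0"
    using rep(1) D0 perp_direction_shift unfolding s1_def s2_def theta_def by blast+
  have ord: "s1 < s0" "s0 < s2" "s2 < s1 + pi"
    using mono[OF D0(1) p0 box(1)] mono[OF p0 D0(2) box(2)] rep(2)[OF D0(1)] rep(3)[OF D0(2)]
    by (auto simp: k s1_def s2_def)
  \<comment> \<open>The three bounds give, for \<open>t1\<close> and \<open>t2\<close> within
    \<open>\<eta>\<close> of \<open>s1\<close> and \<open>s2\<close>, that
    \<open>t1 + pi \<le> d\<close>, \<open>b \<le> t2\<close> and
    \<open>t2 < t1 + pi\<close>.\<close>
  obtain \<eta> where \<eta>: "\<eta> > 0" "\<eta> \<le> (s0 - s1) / 2" "\<eta> \<le> (s2 - s0) / 2" "\<eta> \<le> (s1 + pi - s2) / 3"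
  proof -
    have "\<exists>e>0. e \<le> x \<and> e \<le> y \<and> e \<le> z" if "x > 0" "y > 0" "z > 0" for x y z :: real
      using that by (intro exI[of _ "min x (min y z)"]) auto
    from this[of "(s0 - s1) / 2" "(s2 - s0) / 2" "(s1 + pi - s2) / 3"] show ?thesis
      using that ord by auto
  qed
  then have "\<eta> < pi" using ord by simp
  \<comment> \<open>\<open>b\<close> is halfway between \<open>s0\<close> and \<open>s2\<close>,
    \<open>d\<close> halfway between \<open>s1 + pi\<close> and \<open>s0 + pi\<close>, and
    \<open>\<gamma>\<close> halfway between \<open>d\<close> and \<open>s0 + pi\<close>. All three
    lie inside \<open>(s0, s0 + pi)\<close>, so the gradient at the base point is positive on these
    directions.\<close>
  define b d \<gamma> where "b = (s0 + s2) / 2" and "d = (s1 + s0) / 2 + pi" and "\<gamma> = s0 + pi - (s0 - s1) / 4"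
  have angles: "b \<le> d" "d < \<gamma>" "\<gamma> - b < pi" "s0 < b" "\<gamma> < s0 + pi" "b < s0 + pi" "s0 < \<gamma>"
    using ord by (auto simp: b_def d_def \<gamma>_def field_simps)
  have lim: "((\<lambda>x. slice_grad \<phi> \<alpha> x) \<longlongrightarrow> slice_grad \<phi> \<alpha> x0) (nhds x0)" if "(\<alpha>, x0) \<in> D" for \<alpha>
  proof -
    have "((\<lambda>x. (\<alpha>, x)) \<longlongrightarrow> (\<alpha>, x0)) (nhds x0)"
      by (intro tendsto_Pair tendsto_const filterlim_ident)
    from filterlim_compose[OF G[OF that] this] show ?thesis by (simp add: G_def)
  qed
  have ev1: "\<forall>\<^sub>F x in nhds x0. \<exists>s\<in>theta \<phi> \<alpha> x. \<bar>s - t\<bar> \<le> \<eta>"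
    if "(\<alpha>, x0) \<in> D" "t \<in> theta \<phi> \<alpha> x0" for \<alpha> t
    using that(2) unfolding theta_def
    by (rule perp_direction_perturb[OF lim[OF that(1)] nz[OF that(1)] _ \<open>\<eta> > 0\<close> \<open>\<eta> < pi\<close>])
  have "\<forall>\<^sub>F x in nhds x0. (\<exists>s\<in>theta \<phi> \<alpha>1 x. \<bar>s - s1\<bar> \<le> \<eta>) \<and> (\<exists>s\<in>theta \<phi> \<alpha>2 x. \<bar>s - s2\<bar> \<le> \<eta>)"
    using ev1 D0 s12 by (intro eventually_conj) auto
  then obtain \<rho>1 where \<rho>1: "\<rho>1 > 0" "\<And>x. dist x x0 < \<rho>1 \<Longrightarrow>
      (\<exists>s\<in>theta \<phi> \<alpha>1 x. \<bar>s - s1\<bar> \<le> \<eta>) \<and> (\<exists>s\<in>theta \<phi> \<alpha>2 x. \<bar>s - s2\<bar> \<le> \<eta>)"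
    unfolding eventually_nhds_metric by blast
  have pos0: "G (\<alpha>0, x0) \<bullet> dir b > 0" "G (\<alpha>0, x0) \<bullet> dir \<gamma> > 0"
    using nz[OF p0] angles by (auto simp: G_def s0(2) intro!: mult_pos_pos sin_gt_zero)
  have "((\<lambda>p. G p \<bullet> dir \<psi>) \<longlongrightarrow> G (\<alpha>0, x0) \<bullet> dir \<psi>) (nhds (\<alpha>0, x0))" for \<psi>
    by (intro tendsto_intros G p0)
  then have "\<forall>\<^sub>F p in nhds (\<alpha>0, x0). G p \<bullet> dir b > 0 \<and> G p \<bullet> dir \<gamma> > 0"
    using pos0 by (intro eventually_conj order_tendstoD(1))
  then obtain W where W: "open W" "(\<alpha>0, x0) \<in> W" "\<And>p. p \<in> W \<Longrightarrow> G p \<bullet> dir b > 0 \<and> G p \<bullet> dir \<gamma> > 0"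
    unfolding eventually_nhds by blast
  obtain r2 where r2: "r2 > 0" "cball \<alpha>0 r2 \<times> cball x0 r2 \<subseteq> W"
    using open_contains_box[OF W(1,2)] by blast
  define \<rho> where "\<rho> = min (min r r2) (\<rho>1 / 2)"
  have \<rho>: "\<rho> > 0" "\<rho> \<le> r" "\<rho> \<le> r2" "\<rho> < \<rho>1"
    using r r2 \<rho>1(1) by (auto simp: \<rho>_def min_def)
  have cb: "cball x0 \<rho> \<subseteq> cball x0 r" "cball x0 \<rho> \<subseteq> cball x0 r2" "cball x0 \<rho> \<subseteq> ball x0 \<rho>1"
    using \<rho> by auto
  have in_box: "(\<alpha>, x) \<in> D \<and> (\<alpha>, \<phi> (\<alpha>, x)) \<in> U \<and> x \<in> N"
    if "\<alpha> \<in> cball \<alpha>0 r" "x \<in> cball x0 \<rho>" for \<alpha> x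
  proof -
    have "(\<alpha>, x) \<in> cball \<alpha>0 r \<times> cball x0 r" using that cb(1) by blast
    then have "(\<alpha>, x) \<in> D \<inter> (\<lambda>p. (fst p, \<phi> p)) -` U \<inter> (UNIV \<times> N)" using r(2) by blast
    then show ?thesis by simp
  qed
  show ?thesis
  proof (rule that[of "min r r2" r \<rho> b d \<gamma>])
    show "cball x0 \<rho> \<subseteq> N" using in_box[of \<alpha>0] r(1) by (meson centre_in_cball less_imp_le subsetI)
    show "cball \<alpha>0 r \<times> cball x0 \<rho> \<subseteq> D" using in_box by blast
    show "(\<alpha>, \<phi> (\<alpha>, x)) \<in> U" if "\<alpha> \<in> cball \<alpha>0 r" "x \<in> cball x0 \<rho>" for \<alpha> x
      using in_box that by blast
    show "slice_grad \<phi> \<alpha> x \<bullet> dir \<psi> > 0"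
      if "\<alpha> \<in> cball \<alpha>0 (min r r2)" "x \<in> cball x0 \<rho>" "b \<le> \<psi>" "\<psi> \<le> \<gamma>" for \<alpha> x \<psi>
    proof -
      have "(\<alpha>, x) \<in> cball \<alpha>0 r2 \<times> cball x0 r2" using cb(2) that(1,2) by auto
      then have "(\<alpha>, x) \<in> W" using r2(2) by blast
      from W(3)[OF this] show ?thesis
        using inner_dir_pos_between[of _ b \<gamma>] that(3,4) angles(3) by (simp add: G_def)
    qed
    show "\<exists>s\<in>theta \<phi> \<alpha> x. b \<le> s \<and> s \<le> d" if "\<alpha> \<notin> cball \<alpha>0 r" "x \<in> cball x0 \<rho>" "(\<alpha>, x) \<in> D" for \<alpha> x
    proof -
      have x: "x \<in> cball x0 r" "dist x x0 < \<rho>1" using cb that(2) by (auto simp: dist_commute)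
      obtain t1 t2 where t: "t1 \<in> theta \<phi> \<alpha>1 x" "\<bar>t1 - s1\<bar> \<le> \<eta>" "t2 \<in> theta \<phi> \<alpha>2 x" "\<bar>t2 - s2\<bar> \<le> \<eta>"
        using \<rho>1(2)[OF x(2)] by blast
      have "t1 < t2" "t2 < t1 + pi" "b \<le> t2" "t1 + pi \<le> d"
        using t(2,4) \<eta> ord unfolding b_def d_def by (auto simp: abs_le_iff)
      moreover have "\<alpha> < \<alpha>1 \<or> \<alpha>2 < \<alpha>"
        using that(1) by (auto simp: \<alpha>1_def \<alpha>2_def dist_real_def abs_le_iff)
      ultimately show ?thesis
        using angle_outside_arc[OF ns am D12[OF x(1)] that(3) box(3) _ t(1,3)] by (meson less_le_trans less_imp_le order_trans)
    qed
  qed (use r r2 \<rho> angles in auto)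
qed

lemma slice_strict_mono:
  assumes C1: "C1_on \<phi> D" and B: "convex B" "B \<subseteq> slice D \<alpha>" "x \<in> B" "x + h *\<^sub>R v \<in> B" and h: "h > 0"
    and pos: "\<And>y. y \<in> B \<Longrightarrow> slice_grad \<phi> \<alpha> y \<bullet> v > 0"
  shows "\<phi> (\<alpha>, x) < \<phi> (\<alpha>, x + h *\<^sub>R v)"
proof -
  have "\<exists>y. ((\<lambda>t. \<phi> (\<alpha>, x + t *\<^sub>R v)) has_real_derivative y) (at t) \<and> 0 < y" if t: "0 \<le> t" "t \<le> h" for t
  proof -
    have "x + t *\<^sub>R v = (1 - t / h) *\<^sub>R x + (t / h) *\<^sub>R (x + h *\<^sub>R v)"
      using h by (simp add: algebra_simps)
    also have "\<dots> \<in> B"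
      using t h B by (intro convexD) auto
    finally have tB: "x + t *\<^sub>R v \<in> B" .
    then have "(\<alpha>, x + t *\<^sub>R v) \<in> D" using B(2) by (auto simp: slice_def)
    note der = slice_grad_has_derivative(1)[OF C1 this]
    have "((\<lambda>t. x + t *\<^sub>R v) has_derivative (\<lambda>h. h *\<^sub>R v)) (at t)"
      by (auto intro!: derivative_eq_intros)
    from has_derivative_compose[OF this der]
    have "((\<lambda>t. \<phi> (\<alpha>, x + t *\<^sub>R v)) has_real_derivative slice_grad \<phi> \<alpha> (x + t *\<^sub>R v) \<bullet> v) (at t)"
      unfolding has_field_derivative_def by (simp add: inner_commute mult_commute_abs)
    with pos[OF tB] show ?thesis by blast
  qed
  from DERIV_pos_imp_increasing[OF h this] show ?thesis by simp
qed

section \<open>Measurability and integration over slices\<close>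

text \<open>An open set is a countable union of compact boxes, so its continuous image is a
  countable union of compact sets.\<close>

lemma borel_image_of_open:
  fixes f :: "'a::euclidean_space \<Rightarrow> 'b::t2_space"
  assumes "open W" "continuous_on W f"
  shows "f ` W \<in> sets borel"
proof -
  obtain \<D> where \<D>: "countable \<D>" "\<D> \<subseteq> Pow W" "\<And>X. X \<in> \<D> \<Longrightarrow> \<exists>a b. X = cbox a b" "\<Union>\<D> = W"
    using open_countable_Union_open_cbox[OF assms(1)] by metis
  have "f ` X \<in> sets borel" if "X \<in> \<D>" for X
  proof -
    have "compact X" using \<D>(3)[OF that] by auto
    moreover have "continuous_on X f" using assms(2) \<D>(2) that by (meson PowD continuous_on_subset subsetD)
    ultimately show ?thesis by (intro borel_compact compact_continuous_image)
  qed
  then have "(\<Union>X\<in>\<D>. f ` X) \<in> sets borel" using \<D>(1) by (intro sets.countable_UN') auto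
  also have "(\<Union>X\<in>\<D>. f ` X) = f ` W" using \<D>(4) by blast
  finally show ?thesis .
qed

text \<open>Tonelli's theorem over a strip of width \<open>2 * R\<close>; the slice bound goes
  through supersets to fit \<open>small_shadow\<close>.\<close>

lemma emeasure_lborel_prod_le:
  fixes Z :: "(real \<times> real) set"
  assumes Z: "Z \<in> sets borel" and sub: "\<And>\<alpha> t. (\<alpha>, t) \<in> Z \<Longrightarrow> \<bar>\<alpha>\<bar> \<le> R" and R: "R \<ge> 0" and c: "c \<ge> 0"
    and small: "\<And>\<alpha>. \<exists>Y\<in>sets lborel. {t. (\<alpha>, t) \<in> Z} \<subseteq> Y \<and> emeasure lborel Y \<le> ennreal c"
  shows "emeasure lborel Z \<le> ennreal (c * (2 * R))"
proof -
  have Z': "Z \<in> sets (lborel \<Otimes>\<^sub>M lborel)"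
    unfolding lborel_prod using Z by simp
  have "emeasure lborel Z = emeasure (lborel \<Otimes>\<^sub>M lborel) Z" by (simp add: lborel_prod)
  also have "\<dots> = (\<integral>\<^sup>+\<alpha>. emeasure lborel (Pair \<alpha> -` Z) \<partial>lborel)"
    using Z' by (rule lborel.emeasure_pair_measure_alt)
  also have "\<dots> \<le> (\<integral>\<^sup>+\<alpha>. ennreal c * indicator {-R..R} \<alpha> \<partial>lborel)"
  proof (rule nn_integral_mono)
    fix \<alpha> :: real
    show "emeasure lborel (Pair \<alpha> -` Z) \<le> ennreal c * indicator {-R..R} \<alpha>"
    proof (cases "\<bar>\<alpha>\<bar> \<le> R")
      case True
      obtain Y where Y: "Y \<in> sets lborel" "{t. (\<alpha>, t) \<in> Z} \<subseteq> Y" "emeasure lborel Y \<le> ennreal c"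
        using small by blast
      then have "emeasure lborel (Pair \<alpha> -` Z) \<le> emeasure lborel Y"
        by (intro emeasure_mono) auto
      with Y(3) True show ?thesis by (auto simp: indicator_def abs_le_iff)
    next
      case False
      then have "Pair \<alpha> -` Z = {}" using sub by auto
      then show ?thesis by simp
    qed
  qed
  also have "\<dots> = ennreal c * ennreal (2 * R)"
    using R by (simp add: nn_integral_cmult_indicator)
  also have "\<dots> = ennreal (c * (2 * R))" using c R by (simp add: ennreal_mult)
  finally show ?thesis .
qed

text \<open>It is essential that \<open>V\<close> does not depend on \<open>\<epsilon>\<close>: a countable subcover by such sets has to be
  chosen before the error is distributed among its members.\<close>

lemma local_covering:
  assumes D: "open D" and adm: "admissible \<phi> D"
    and p0: "(\<alpha>0, x0) \<in> D" and U: "open U" "(\<alpha>0, \<phi> (\<alpha>0, x0)) \<in> U" and N: "open N" "x0 \<in> N"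
  shows "\<exists>V. open V \<and> (\<alpha>0, \<phi> (\<alpha>0, x0)) \<in> V \<and> (\<forall>\<epsilon>>0. \<forall>R>0. \<exists>E. open E \<and> compact (closure E) \<and> closure E \<subseteq> N \<and>
      (\<forall>\<alpha> t. (\<alpha>, t) \<in> V \<longrightarrow> {\<alpha>} \<times> closure E \<subseteq> D \<and> t \<in> (\<lambda>x. \<phi> (\<alpha>, x)) ` E) \<and>
      (\<exists>Z\<in>sets lborel. emeasure lborel Z \<le> ennreal \<epsilon> \<and>
        {(\<alpha>, \<phi> (\<alpha>, x)) |\<alpha> x. (\<alpha>, x) \<in> D \<and> x \<in> E \<and> \<bar>\<alpha>\<bar> < R} - U \<subseteq> Z))"
proof -
  have C1: "C1_on \<phi> D" and ns: "non_stationary \<phi> D" and am: "angle_monotonicity \<phi> D"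
    and rs: "rectangle_squishing \<phi> D" using adm by (auto simp: admissible_def)
  have \<phi>_cont: "continuous_on D \<phi>" by (rule C1_on_imp_continuous_on[OF C1])
  obtain r' r \<rho> b d \<gamma> where r: "0 < r'" "r' \<le> r" "0 < \<rho>"
    and angles: "b \<le> d" "d < \<gamma>" "\<gamma> - b < pi"
    and box: "cball x0 \<rho> \<subseteq> N" "cball \<alpha>0 r \<times> cball x0 \<rho> \<subseteq> D"
    and inU: "\<And>\<alpha> x. \<alpha> \<in> cball \<alpha>0 r \<Longrightarrow> x \<in> cball x0 \<rho> \<Longrightarrow> (\<alpha>, \<phi> (\<alpha>, x)) \<in> U"
    and pos: "\<And>\<alpha> x \<psi>. \<lbrakk>\<alpha> \<in> cball \<alpha>0 r'; x \<in> cball x0 \<rho>; b \<le> \<psi>; \<psi> \<le> \<gamma>\<rbrakk> \<Longrightarrow> slice_grad \<phi> \<alpha> x \<bullet> dir \<psi> > 0"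
    and out: "\<And>\<alpha> x. \<lbrakk>\<alpha> \<notin> cball \<alpha>0 r; x \<in> cball x0 \<rho>; (\<alpha>, x) \<in> D\<rbrakk> \<Longrightarrow> \<exists>s\<in>theta \<phi> \<alpha> x. b \<le> s \<and> s \<le> d"
    by (rule local_directions[OF D C1 ns am p0 U N]) (rule that; assumption)
  define B where "B = ball x0 \<rho>"
  have B: "convex B" "B \<subseteq> cball x0 \<rho>" by (auto simp: B_def)
  have cb: "cball \<alpha>0 r' \<subseteq> cball \<alpha>0 r" using r by auto
  have BD: "B \<subseteq> slice D \<alpha>" if "\<alpha> \<in> cball \<alpha>0 r'" for \<alpha>
  proof
    fix x assume "x \<in> B"
    then have "(\<alpha>, x) \<in> cball \<alpha>0 r \<times> cball x0 \<rho>" using B cb that by blast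
    then show "x \<in> slice D \<alpha>" using box(2) by (auto simp: slice_def)
  qed
  then have inD: "(\<alpha>, x) \<in> D" if "\<alpha> \<in> cball \<alpha>0 r'" "x \<in> B" for \<alpha> x
    using that by (auto simp: slice_def)
  have smono: "\<phi> (\<alpha>, x) < \<phi> (\<alpha>, x + h *\<^sub>R dir \<psi>)"
    if "\<alpha> \<in> cball \<alpha>0 r'" "x \<in> B" "b \<le> \<psi>" "\<psi> \<le> \<gamma>" "0 < h" "x + h *\<^sub>R dir \<psi> \<in> B" for \<alpha> x \<psi> h
    using that pos B by (intro slice_strict_mono[OF C1 B(1) BD]) auto
  \<comment> \<open>The segment has direction \<open>b\<close> and midpoint \<open>x0\<close>; with
    its \<open>\<rho> / 4\<close>-neighbourhood it stays in the ball of radius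
    \<open>\<rho> / 2\<close>, which leaves room for closures.\<close>
  define p where "p = x0 - (\<rho> / 4) *\<^sub>R dir b"
  define l where "l = \<rho> / 2"
  define q where "q = p + l *\<^sub>R dir b"
  have l: "l > 0" using r by (simp add: l_def)
  have q: "q = x0 + (\<rho> / 4) *\<^sub>R dir b"
    by (simp add: q_def p_def l_def flip: scaleR_left_distrib) (simp add: algebra_simps flip: scaleR_left_distrib)
  have pqB: "p \<in> B" "q \<in> B" "x0 \<in> B"
    using r by (auto simp: B_def p_def q dist_norm)
  have nb: "nbhd (\<rho> / 4) (closed_segment p q) \<subseteq> ball x0 (\<rho> / 2)"
  proof
    fix y assume "y \<in> nbhd (\<rho> / 4) (closed_segment p q)"
    then obtain z where z: "z \<in> closed_segment p q" "dist z y < \<rho> / 4" by (rule nbhdE)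
    have "closed_segment p q \<subseteq> cball x0 (\<rho> / 4)"
      using r by (intro closed_segment_subset) (auto simp: p_def q dist_norm)
    then have "dist x0 z \<le> \<rho> / 4" using z by auto
    then show "y \<in> ball x0 (\<rho> / 2)" using z(2) dist_triangle[of x0 y z] by simp
  qed
  moreover have half: "ball x0 (\<rho> / 2) \<subseteq> B" using r unfolding B_def by (intro subset_ball) simp
  ultimately have nbB: "nbhd (\<rho> / 4) (closed_segment p q) \<subseteq> B" by blast
  have \<alpha>0: "\<alpha>0 \<in> cball \<alpha>0 r'" using r by simp
  have "\<phi> (\<alpha>0, p) < \<phi> (\<alpha>0, x0)" "\<phi> (\<alpha>0, x0) < \<phi> (\<alpha>0, q)"
    using smono[OF \<alpha>0 pqB(1), of b "\<rho> / 4"] smono[OF \<alpha>0 pqB(3), of b "\<rho> / 4"] pqB r angles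
    by (auto simp: p_def q)
  \<comment> \<open>The points strictly between the curves of \<open>p\<close> and \<open>q\<close>,
    over parameters near \<open>\<alpha>0\<close>: a blind for this segment covers them however fine
    it is.\<close>
  moreover define V where "V = (ball \<alpha>0 r' \<times> UNIV) \<inter>
      (\<lambda>y. (snd y - \<phi> (fst y, p), \<phi> (fst y, q) - snd y)) -` ({0<..} \<times> {0<..})"
  moreover have "open V"
    unfolding V_def
  proof (rule continuous_open_preimage)
    have "continuous_on (ball \<alpha>0 r' \<times> (UNIV :: real set)) (\<lambda>y. \<phi> (fst y, x))" if "x \<in> B" for x
      by (rule continuous_on_compose2[OF \<phi>_cont]) (use that in \<open>auto intro!: continuous_intros inD\<close>)
    then show "continuous_on (ball \<alpha>0 r' \<times> UNIV) (\<lambda>y. (snd y - \<phi> (fst y, p), \<phi> (fst y, q) - snd y))"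
      using pqB by (intro continuous_intros) auto
  qed (auto intro!: open_Times)
  ultimately have V: "open V" "(\<alpha>0, \<phi> (\<alpha>0, x0)) \<in> V" using r by auto
  have "\<exists>E. open E \<and> compact (closure E) \<and> closure E \<subseteq> N \<and>
      (\<forall>\<alpha> t. (\<alpha>, t) \<in> V \<longrightarrow> {\<alpha>} \<times> closure E \<subseteq> D \<and> t \<in> (\<lambda>x. \<phi> (\<alpha>, x)) ` E) \<and>
      (\<exists>Z\<in>sets lborel. emeasure lborel Z \<le> ennreal \<epsilon> \<and>
        {(\<alpha>, \<phi> (\<alpha>, x)) |\<alpha> x. (\<alpha>, x) \<in> D \<and> x \<in> E \<and> \<bar>\<alpha>\<bar> < R} - U \<subseteq> Z)"
    if \<epsilon>: "\<epsilon> > 0" and R: "R > 0" for \<epsilon> R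
  proof -
    \<comment> \<open>The shadow for one parameter will be at most
      \<open>\<kappa> * l = \<epsilon> / (2 * R)\<close>, and the parameters range over an interval
      of length \<open>2 * R\<close>.\<close>
    define \<kappa> where "\<kappa> = \<epsilon> / (2 * R * l)"
    have \<kappa>: "\<kappa> > 0" using \<epsilon> R l by (simp add: \<kappa>_def)
    \<comment> \<open>The minimum of the weight over \<open>[b, d]\<close> turns the unweighted
      squishing bound into the weighted one of the locale.\<close>
    have "\<exists>\<psi>0\<in>{b..d}. \<forall>\<psi>\<in>{b..d}. sin (\<gamma> - \<psi>0) \<le> sin (\<gamma> - \<psi>)"
      using angles by (intro continuous_attains_inf) (auto intro!: continuous_intros)
    then obtain \<psi>0 where \<psi>0: "\<psi>0 \<in> {b..d}" "\<And>\<psi>. \<psi> \<in> {b..d} \<Longrightarrow> sin (\<gamma> - \<psi>0) \<le> sin (\<gamma> - \<psi>)" by blast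
    define m where "m = sin (\<gamma> - \<psi>0)"
    have m: "m > 0" using \<psi>0(1) angles by (auto simp: m_def intro!: sin_gt_zero)
    \<comment> \<open>The cutoff by \<open>R\<close> is what makes squishing uniform, since it is
      uniform on bounded sets.\<close>
    define D' where "D' = D \<inter> (cball 0 R \<times> cball x0 \<rho>)"
    have D': "bounded D' \<and> D' \<subseteq> D \<and> \<kappa> * m > 0"
      using \<kappa> m by (auto simp: D'_def intro!: bounded_Int bounded_Times)
    obtain \<delta> where \<delta>: "\<delta> > 0" and sq: "\<And>p q \<alpha>.
        p \<noteq> q \<and> dist p q \<le> \<delta> \<and>
        (\<exists>x \<in> slice D' \<alpha> \<inter> nbhd (\<delta> * dist p q) (closed_segment p q).
           setdist (theta \<phi> \<alpha> x) (direction (q - p)) \<le> \<delta>) \<Longrightarrow>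
        (\<exists>c e. e - c \<le> (\<kappa> * m) * dist p q \<and>
           (\<lambda>x. \<phi> (\<alpha>, x)) ` (nbhd (\<delta> * dist p q) (closed_segment p q) \<inter> slice D \<alpha>) \<subseteq> {c..e})"
      using rs D' unfolding rectangle_squishing_def by meson
    \<comment> \<open>Over \<open>cball \<alpha>0 r\<close> the curves stay in \<open>U\<close>; the
      remaining parameters are those to be squished.\<close>
    define J where "J = {\<alpha>. \<bar>\<alpha>\<bar> < R \<and> \<alpha> \<notin> cball \<alpha>0 r}"
    interpret venetian_blind "\<lambda>\<alpha> x. \<phi> (\<alpha>, x)" "slice D" "theta \<phi>" "cball \<alpha>0 r'" J B b d \<gamma> \<delta> \<kappa>
    proof
      show "\<phi> (\<alpha>, x) \<le> \<phi> (\<alpha>, x + h *\<^sub>R dir \<psi>)"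
        if "\<alpha> \<in> cball \<alpha>0 r'" "x \<in> B" "b \<le> \<psi>" "\<psi> \<le> \<gamma>" "0 \<le> h" "x + h *\<^sub>R dir \<psi> \<in> B" for \<alpha> x \<psi> h
        using smono[of \<alpha> x \<psi> h] that by (cases "h = 0") auto
      show "continuous_on B (\<lambda>x. \<phi> (\<alpha>, x))" if "\<alpha> \<in> cball \<alpha>0 r'" for \<alpha>
        by (rule continuous_on_compose2[OF \<phi>_cont]) (use that in \<open>auto intro!: continuous_intros inD\<close>)
      show "\<exists>c e. e - c \<le> \<kappa> * l * sin (\<gamma> - \<psi>) \<and>
            (\<lambda>x. \<phi> (\<alpha>, x)) ` (nbhd (\<delta> * l) (closed_segment p (p + l *\<^sub>R dir \<psi>)) \<inter> slice D \<alpha>) \<subseteq> {c..e}"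
        if \<alpha>: "\<alpha> \<in> J" and \<psi>: "b \<le> \<psi>" "\<psi> \<le> d" and l: "0 < l" "l \<le> \<delta>"
          and x: "x \<in> slice D \<alpha> \<inter> B \<inter> nbhd (\<delta> * l) (closed_segment p (p + l *\<^sub>R dir \<psi>))"
          and s: "s \<in> theta \<phi> \<alpha> x" "\<bar>s - \<psi>\<bar> \<le> \<delta>" for \<alpha> \<psi> l p x s
      proof -
        let ?q = "p + l *\<^sub>R dir \<psi>"
        have dpq: "dist p ?q = l" using l by (simp add: dist_norm)
        have "x \<in> slice D' \<alpha>"
          using x \<alpha> B(2) by (auto simp: slice_def D'_def J_def)
        moreover have "setdist (theta \<phi> \<alpha> x) (direction (?q - p)) \<le> \<delta>"
          using setdist_le_dist[OF s(1) mem_direction_dir[OF l(1), of \<psi>]] s(2) by (simp add: dist_real_def)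
        ultimately obtain c e where ce: "e - c \<le> (\<kappa> * m) * l"
          "(\<lambda>x. \<phi> (\<alpha>, x)) ` (nbhd (\<delta> * l) (closed_segment p ?q) \<inter> slice D \<alpha>) \<subseteq> {c..e}"
          using sq[of p ?q \<alpha>] l x unfolding dpq by auto
        have "(\<kappa> * m) * l \<le> \<kappa> * l * sin (\<gamma> - \<psi>)"
          using \<psi>0(2)[of \<psi>] \<psi> \<kappa> l by (simp add: m_def)
        with ce show ?thesis by (meson order_trans)
      qed
    qed (use angles \<delta> \<kappa> in auto)
    obtain E where E: "blind b b p l (\<rho> / 4) E"
      using blind_exists[of l "\<rho> / 4" p] l r nbB unfolding q_def by auto
    then have Eo: "open E" and Esub: "E \<subseteq> ball x0 (\<rho> / 2)"
      and Ecov: "\<And>\<alpha>. \<alpha> \<in> cball \<alpha>0 r' \<Longrightarrow> {\<phi> (\<alpha>, p)..\<phi> (\<alpha>, q)} \<subseteq> (\<lambda>x. \<phi> (\<alpha>, x)) ` E"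
      using nb unfolding blind_def q_def by blast+
    have EB: "E \<subseteq> cball x0 \<rho>" using Esub half B(2) by blast
    have "closure E \<subseteq> cball x0 (\<rho> / 2)"
      using Esub ball_subset_cball by (intro closure_minimal) blast+
    moreover have "cball x0 (\<rho> / 2) \<subseteq> cball x0 \<rho>" using r by auto
    ultimately have cl: "closure E \<subseteq> cball x0 \<rho>" by blast
    have shadow: "small_shadow E \<alpha> (\<kappa> * l * sin (\<gamma> - b))" if "\<alpha> \<in> J" for \<alpha>
    proof -
      have "\<forall>x\<in>E \<inter> slice D \<alpha>. \<exists>s\<in>theta \<phi> \<alpha> x. b \<le> s \<and> s \<le> d"
        using out that EB by (auto simp: J_def slice_def subset_iff)
      with E that show ?thesis unfolding blind_def by blast
    qed
    define W where "W = D \<inter> ((ball 0 R - cball \<alpha>0 r) \<times> E)"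
    define Z where "Z = (\<lambda>y. (fst y, \<phi> y)) ` W"
    have "open W" unfolding W_def using D Eo by (intro open_Int open_Times open_Diff) auto
    moreover have "continuous_on W \<phi>"
      by (rule continuous_on_subset[OF \<phi>_cont]) (auto simp: W_def)
    then have "continuous_on W (\<lambda>y. (fst y, \<phi> y))" by (intro continuous_intros)
    ultimately have Z: "Z \<in> sets borel" unfolding Z_def by (rule borel_image_of_open)
    have "emeasure lborel Z \<le> ennreal (\<epsilon> / (2 * R) * (2 * R))"
    proof (rule emeasure_lborel_prod_le[OF Z])
      show "\<bar>\<alpha>\<bar> \<le> R" if "(\<alpha>, t) \<in> Z" for \<alpha> t
        using that by (auto simp: Z_def W_def)
      show "\<exists>Y\<in>sets lborel. {t. (\<alpha>, t) \<in> Z} \<subseteq> Y \<and> emeasure lborel Y \<le> ennreal (\<epsilon> / (2 * R))" for \<alpha>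
      proof (cases "\<alpha> \<in> J")
        case True
        then obtain Y where Y: "Y \<in> sets lborel" "(\<lambda>x. \<phi> (\<alpha>, x)) ` (E \<inter> slice D \<alpha>) \<subseteq> Y"
          "emeasure lborel Y \<le> ennreal (\<kappa> * l * sin (\<gamma> - b))"
          using shadow unfolding small_shadow_def by blast
        have "\<kappa> * l * sin (\<gamma> - b) \<le> \<kappa> * l * 1"
          using \<kappa> l by (intro mult_left_mono) auto
        also have "\<dots> = \<epsilon> / (2 * R)" using l by (simp add: \<kappa>_def)
        finally have "emeasure lborel Y \<le> ennreal (\<epsilon> / (2 * R))"
          using Y(3) by (meson ennreal_leI order_trans)
        moreover have "{t. (\<alpha>, t) \<in> Z} \<subseteq> Y"
          using Y(2) by (auto simp: Z_def W_def slice_def)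
        ultimately show ?thesis using Y(1) by blast
      next
        case False
        then have "{t. (\<alpha>, t) \<in> Z} = {}" by (auto simp: Z_def W_def J_def)
        then show ?thesis by (intro bexI[of _ "{}"]) auto
      qed
    qed (use R \<epsilon> in auto)
    then have "emeasure lborel Z \<le> ennreal \<epsilon>" using R by simp
    moreover have "{(\<alpha>, \<phi> (\<alpha>, x)) |\<alpha> x. (\<alpha>, x) \<in> D \<and> x \<in> E \<and> \<bar>\<alpha>\<bar> < R} - U \<subseteq> Z"
    proof
      fix y assume "y \<in> {(\<alpha>, \<phi> (\<alpha>, x)) |\<alpha> x. (\<alpha>, x) \<in> D \<and> x \<in> E \<and> \<bar>\<alpha>\<bar> < R} - U"
      then obtain \<alpha> x where y: "y = (\<alpha>, \<phi> (\<alpha>, x))" "(\<alpha>, x) \<in> D" "x \<in> E" "\<bar>\<alpha>\<bar> < R" "y \<notin> U" by blast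
      then have "\<alpha> \<notin> cball \<alpha>0 r" using inU EB by blast
      then have "(\<alpha>, x) \<in> W" using y by (auto simp: W_def)
      then show "y \<in> Z" unfolding Z_def y(1) by force
    qed
    moreover have "{\<alpha>} \<times> closure E \<subseteq> D" "t \<in> (\<lambda>x. \<phi> (\<alpha>, x)) ` E" if "(\<alpha>, t) \<in> V" for \<alpha> t
    proof -
      have \<alpha>: "\<alpha> \<in> cball \<alpha>0 r'" and t: "t \<in> {\<phi> (\<alpha>, p)..\<phi> (\<alpha>, q)}"
        using that unfolding V_def by auto
      show "{\<alpha>} \<times> closure E \<subseteq> D" using \<alpha> cb cl box(2) by blast
      show "t \<in> (\<lambda>x. \<phi> (\<alpha>, x)) ` E" using Ecov[OF \<alpha>] t by blast
    qed
    moreover have "compact (closure E)"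
      using cl by (meson bounded_cball bounded_subset closed_closure compact_eq_bounded_closed)
    ultimately show ?thesis
      using Eo Z cl box(1) by (intro exI[of _ E] conjI allI impI bexI[of _ Z]) auto
  qed
  with V show ?thesis by blast
qed

section \<open>The tree of refinements\<close>

text \<open>In a pair \<open>(E, V)\<close>, the curves of the parameters in \<open>E\<close> cover \<open>V\<close>.\<close>

definition graph_over :: "(space \<Rightarrow> real) \<Rightarrow> space set \<Rightarrow> plane set \<Rightarrow> real \<Rightarrow> plane set" where
  "graph_over \<phi> D E R = {(\<alpha>, \<phi> (\<alpha>, x)) |\<alpha> x. (\<alpha>, x) \<in> D \<and> x \<in> E \<and> \<bar>\<alpha>\<bar> < R}"

definition covers_set :: "(space \<Rightarrow> real) \<Rightarrow> space set \<Rightarrow> plane set \<times> plane set \<Rightarrow> bool" where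
  "covers_set \<phi> D P \<longleftrightarrow> open (fst P) \<and>
    (\<forall>\<alpha> t. (\<alpha>, t) \<in> snd P \<longrightarrow> (\<exists>x\<in>fst P. (\<alpha>, x) \<in> D \<and> \<phi> (\<alpha>, x) = t))"

text \<open>Compact closures, inside the parent and inside the slices of \<open>D\<close>, ensure
  that limits of nested parameter sets are again parameters of curves.\<close>

definition child_of :: "space set \<Rightarrow> plane set \<times> plane set \<Rightarrow> plane set \<times> plane set \<Rightarrow> bool" where
  "child_of D P Q \<longleftrightarrow> compact (closure (fst Q)) \<and> closure (fst Q) \<subseteq> fst P \<and>
    (\<forall>\<alpha> t. (\<alpha>, t) \<in> snd Q \<longrightarrow> {\<alpha>} \<times> closure (fst Q) \<subseteq> D)"

text \<open>Local covers at all points of \<open>snd P \<inter> U\<close> are thinned to countably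
  many by the Lindelof property; only then are the errors assigned, with sum at most
  \<open>\<epsilon>\<close>.\<close>

lemma refinement_step:
  assumes D: "open D" and adm: "admissible \<phi> D" and U: "open U" and \<epsilon>: "\<epsilon> > 0" and R: "R > 0"
    and \<F>: "countable \<F>" "\<And>P. P \<in> \<F> \<Longrightarrow> covers_set \<phi> D P"
  obtains \<G> where "countable \<G>" "\<And>Q. Q \<in> \<G> \<Longrightarrow> covers_set \<phi> D Q"
    "\<And>P y. P \<in> \<F> \<Longrightarrow> y \<in> snd P \<inter> U \<Longrightarrow> \<exists>Q\<in>\<G>. child_of D P Q \<and> y \<in> snd Q"
    "\<exists>Z\<in>sets lborel. emeasure lborel Z \<le> ennreal \<epsilon> \<and> (\<Union>Q\<in>\<G>. graph_over \<phi> D (fst Q) R) - U \<subseteq> Z"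
proof -
  let ?good = "\<lambda>P V e E. open E \<and> covers_set \<phi> D (E, V) \<and> child_of D P (E, V) \<and>
      (\<exists>Z\<in>sets lborel. emeasure lborel Z \<le> ennreal e \<and> graph_over \<phi> D E R - U \<subseteq> Z)"
  have "\<exists>V. open V \<and> y \<in> V \<and> (\<forall>e>0. \<exists>E. ?good P V e E)" if P: "P \<in> \<F>" and y: "y \<in> snd P \<inter> U" for P y
  proof -
    obtain \<alpha>0 t where y0: "y = (\<alpha>0, t)" by (cases y)
    obtain x0 where x0: "x0 \<in> fst P" "(\<alpha>0, x0) \<in> D" "\<phi> (\<alpha>0, x0) = t" and o: "open (fst P)"
      using \<F>(2)[OF P] y unfolding covers_set_def y0 by blast
    have yU: "(\<alpha>0, \<phi> (\<alpha>0, x0)) \<in> U" using y x0(3) y0 by simp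
    obtain V where V: "open V" "(\<alpha>0, \<phi> (\<alpha>0, x0)) \<in> V" and
      *: "\<forall>\<epsilon>>0. \<forall>R>0. \<exists>E. open E \<and> compact (closure E) \<and> closure E \<subseteq> fst P \<and>
      (\<forall>\<alpha> t. (\<alpha>, t) \<in> V \<longrightarrow> {\<alpha>} \<times> closure E \<subseteq> D \<and> t \<in> (\<lambda>x. \<phi> (\<alpha>, x)) ` E) \<and>
      (\<exists>Z\<in>sets lborel. emeasure lborel Z \<le> ennreal \<epsilon> \<and>
        {(\<alpha>, \<phi> (\<alpha>, x)) |\<alpha> x. (\<alpha>, x) \<in> D \<and> x \<in> E \<and> \<bar>\<alpha>\<bar> < R} - U \<subseteq> Z)"
      using local_covering[OF D adm x0(2) U yU o x0(1)] by blast
    have "\<exists>E. ?good P V e E" if e: "e > 0" for e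
    proof -
      obtain E where E: "open E" "compact (closure E)" "closure E \<subseteq> fst P"
        "\<And>\<alpha> t. (\<alpha>, t) \<in> V \<Longrightarrow> {\<alpha>} \<times> closure E \<subseteq> D \<and> t \<in> (\<lambda>x. \<phi> (\<alpha>, x)) ` E"
        "\<exists>Z\<in>sets lborel. emeasure lborel Z \<le> ennreal e \<and> graph_over \<phi> D E R - U \<subseteq> Z"
        using *[rule_format, OF e R] unfolding graph_over_def by blast
      have "covers_set \<phi> D (E, V)"
        unfolding covers_set_def fst_conv snd_conv
      proof (intro conjI allI impI E(1))
        fix \<alpha> t assume "(\<alpha>, t) \<in> V"
        from E(4)[OF this] show "\<exists>x\<in>E. (\<alpha>, x) \<in> D \<and> \<phi> (\<alpha>, x) = t"
          using closure_subset[of E] by blast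
      qed
      moreover have "child_of D P (E, V)"
        using E(2-4) by (auto simp: child_of_def)
      ultimately show ?thesis using E(1,5) by blast
    qed
    then show ?thesis using V x0(3) y0 by blast
  qed
  then have "\<forall>P\<in>\<F>. \<forall>y\<in>snd P \<inter> U. \<exists>V. open V \<and> y \<in> V \<and> (\<forall>e>0. \<exists>E. ?good P V e E)"
    by blast
  then obtain V where V: "\<And>P y. P \<in> \<F> \<Longrightarrow> y \<in> snd P \<inter> U \<Longrightarrow>
      open (V P y) \<and> y \<in> V P y \<and> (\<forall>e>0. \<exists>E. ?good P (V P y) e E)"
    by metis
  have "\<exists>Y. Y \<subseteq> snd P \<inter> U \<and> countable Y \<and> snd P \<inter> U \<subseteq> (\<Union>y\<in>Y. V P y)" if P: "P \<in> \<F>" for P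
  proof -
    have V': "open (V P y)" "y \<in> V P y" if "y \<in> snd P \<inter> U" for y
      using V[OF P that] by blast+
    then have "\<And>S. S \<in> V P ` (snd P \<inter> U) \<Longrightarrow> open S" by blast
    from Lindelof[OF this] obtain \<V> where \<V>: "\<V> \<subseteq> V P ` (snd P \<inter> U)" "countable \<V>"
      "\<Union>\<V> = \<Union>(V P ` (snd P \<inter> U))" .
    then obtain Y where Y: "Y \<subseteq> snd P \<inter> U" "countable Y" "\<V> = V P ` Y"
      by (meson countable_subset_image)
    have "snd P \<inter> U \<subseteq> \<Union>(V P ` (snd P \<inter> U))" using V'(2) by blast
    then have "snd P \<inter> U \<subseteq> (\<Union>y\<in>Y. V P y)" unfolding \<V>(3)[symmetric] Y(3) .
    with Y(1,2) show ?thesis by blast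
  qed
  then obtain Y where Y: "\<And>P. P \<in> \<F> \<Longrightarrow> Y P \<subseteq> snd P \<inter> U" "\<And>P. P \<in> \<F> \<Longrightarrow> countable (Y P)"
    "\<And>P. P \<in> \<F> \<Longrightarrow> snd P \<inter> U \<subseteq> (\<Union>y\<in>Y P. V P y)"
    by metis
  define K where "K = Sigma \<F> Y"
  have "countable K" unfolding K_def using \<F>(1) Y(2) by (intro countable_SIGMA)
  then obtain n :: "_ \<Rightarrow> nat" where n: "inj_on n K" unfolding countable_def by blast
  \<comment> \<open>With \<open>Suc\<close> the weights add up to at most 1 over the injective
    numbering \<open>n\<close>.\<close>
  define e where "e k = \<epsilon> * (1 / 2) ^ Suc (n k)" for k
  have "\<forall>k\<in>K. \<exists>E. ?good (fst k) (V (fst k) (snd k)) (e k) E"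
  proof
    fix k assume "k \<in> K"
    then have "fst k \<in> \<F>" "snd k \<in> Y (fst k)" by (auto simp: K_def)
    moreover from this have "snd k \<in> snd (fst k) \<inter> U" using Y(1) by blast
    moreover have "e k > 0" using \<epsilon> by (simp add: e_def)
    ultimately show "\<exists>E. ?good (fst k) (V (fst k) (snd k)) (e k) E"
      using V[of "fst k" "snd k"] by blast
  qed
  then obtain E where E: "\<And>k. k \<in> K \<Longrightarrow> ?good (fst k) (V (fst k) (snd k)) (e k) (E k)"
    by metis
  then have "\<forall>k\<in>K. \<exists>Z. Z \<in> sets lborel \<and> emeasure lborel Z \<le> ennreal (e k) \<and> graph_over \<phi> D (E k) R - U \<subseteq> Z"
    by blast
  from bchoice[OF this] obtain Z where Z: "\<And>k. k \<in> K \<Longrightarrow> Z k \<in> sets lborel"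
    "\<And>k. k \<in> K \<Longrightarrow> emeasure lborel (Z k) \<le> ennreal (e k)"
    "\<And>k. k \<in> K \<Longrightarrow> graph_over \<phi> D (E k) R - U \<subseteq> Z k"
    by blast
  define \<G> where "\<G> = (\<lambda>k. (E k, V (fst k) (snd k))) ` K"
  show ?thesis
  proof (rule that[of \<G>])
    show "countable \<G>" unfolding \<G>_def using \<open>countable K\<close> by simp
    show "covers_set \<phi> D Q" if "Q \<in> \<G>" for Q
      using that E unfolding \<G>_def by blast
    show "\<exists>Q\<in>\<G>. child_of D P Q \<and> y \<in> snd Q" if P: "P \<in> \<F>" and y: "y \<in> snd P \<inter> U" for P y
    proof -
      obtain z where z: "z \<in> Y P" "y \<in> V P z" using Y(3)[OF P] y by blast
      have k: "(P, z) \<in> K" using P z(1) by (simp add: K_def)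
      then have "(E (P, z), V P z) \<in> \<G>" unfolding \<G>_def by force
      moreover have "child_of D P (E (P, z), V P z)" using E[OF k] by simp
      ultimately show ?thesis using z(2) by force
    qed
    show "\<exists>Z\<in>sets lborel. emeasure lborel Z \<le> ennreal \<epsilon> \<and> (\<Union>Q\<in>\<G>. graph_over \<phi> D (fst Q) R) - U \<subseteq> Z"
    proof (intro bexI conjI)
      define Z' where "Z' i = (\<Union>k\<in>{k\<in>K. n k = i}. Z k)" for i
      have Z': "Z' i \<in> sets lborel \<and> emeasure lborel (Z' i) \<le> ennreal (\<epsilon> * (1 / 2) ^ Suc i)" for i
      proof (cases "\<exists>k\<in>K. n k = i")
        case True
        then obtain k where k: "k \<in> K" "n k = i" by blast
        then have "{k\<in>K. n k = i} = {k}" using n by (auto simp: inj_on_def)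
        then have "Z' i = Z k" by (simp add: Z'_def)
        then show ?thesis using Z(1,2)[OF k(1)] k(2) by (simp add: e_def)
      next
        case False
        then have "Z' i = {}" by (auto simp: Z'_def)
        then show ?thesis by simp
      qed
      have "emeasure lborel (\<Union>i. Z' i) \<le> (\<Sum>i. emeasure lborel (Z' i))"
        using Z' by (intro emeasure_subadditive_countably) auto
      also have "\<dots> \<le> (\<Sum>i. ennreal (\<epsilon> * (1 / 2) ^ Suc i))"
        using Z' by (intro suminf_le) auto
      also have "\<dots> = ennreal \<epsilon>"
        using \<epsilon> sums_mult[OF power_half_series, of \<epsilon>] by (intro suminf_ennreal_eq) auto
      finally show "emeasure lborel (\<Union>i. Z' i) \<le> ennreal \<epsilon>" .
      show "(\<Union>i. Z' i) \<in> sets lborel" using Z' by blast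
      show "(\<Union>Q\<in>\<G>. graph_over \<phi> D (fst Q) R) - U \<subseteq> (\<Union>i. Z' i)"
      proof
        fix y assume "y \<in> (\<Union>Q\<in>\<G>. graph_over \<phi> D (fst Q) R) - U"
        then obtain k where k: "k \<in> K" "y \<in> graph_over \<phi> D (E k) R - U"
          unfolding \<G>_def by auto
        then have "y \<in> Z' (n k)" using Z(3)[OF k(1)] unfolding Z'_def by blast
        then show "y \<in> (\<Union>i. Z' i)" by blast
      qed
    qed
  qed
qed

text \<open>Level \<open>n + 1\<close> of the tree has error at most \<open>\<epsilon> n\<close>
  outside the open set \<open>U n\<close>, measured over
  \<open>\<bar>\<alpha>\<bar> < n + 1\<close>. A parameter in \<open>E\<close> lies in some member
  of every level, so the excess over \<open>F\<close> in this range is contained in the exceptional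
  set of the level and \<open>U n - F\<close>. Each point of \<open>F\<close> is covered along a
  branch through it.\<close>

lemma efficient_covering_if_admissible:
  assumes D: "open D" and adm: "admissible \<phi> D"
    and F: "F \<in> sets lebesgue" "\<And>\<alpha> t. (\<alpha>, t) \<in> F \<Longrightarrow> \<exists>x. (\<alpha>, x) \<in> D \<and> \<phi> (\<alpha>, x) = t"
  obtains E where "\<And>\<alpha> t. (\<alpha>, t) \<in> F \<Longrightarrow> \<exists>x\<in>E. (\<alpha>, x) \<in> D \<and> \<phi> (\<alpha>, x) = t"
    "{(\<alpha>, \<phi> (\<alpha>, x)) |\<alpha> x. (\<alpha>, x) \<in> D \<and> x \<in> E} - F \<in> null_sets lebesgue"
proof -
  define \<epsilon> :: "nat \<Rightarrow> real" where "\<epsilon> n = (1 / 2) ^ n" for n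
  have \<epsilon>: "\<epsilon> n > 0" for n by (simp add: \<epsilon>_def)
  have "\<exists>U. open U \<and> F \<subseteq> U \<and> U - F \<in> sets lebesgue \<and> emeasure lebesgue (U - F) \<le> ennreal (\<epsilon> n)" for n
  proof -
    obtain T where T: "open T" "F \<subseteq> T" "T - F \<in> lmeasurable" "emeasure lebesgue (T - F) < ennreal (\<epsilon> n)"
      using sets_lebesgue_outer_open[OF F(1) \<epsilon>[of n]] .
    then show ?thesis
      using fmeasurableD[OF T(3)] by (intro exI[of _ T] conjI) simp_all
  qed
  then obtain U where U: "\<And>n. open (U n)" "\<And>n. F \<subseteq> U n" "\<And>n. U n - F \<in> sets lebesgue"
    "\<And>n. emeasure lebesgue (U n - F) \<le> ennreal (\<epsilon> n)"
    by metis
  define small :: "nat \<Rightarrow> (plane set \<times> plane set) set \<Rightarrow> bool" where "small n \<G> \<longleftrightarrow> (\<exists>Z\<in>sets lborel. emeasure lborel Z \<le> ennreal (\<epsilon> n) \<and>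
      (\<Union>Q\<in>\<G>. graph_over \<phi> D (fst Q) (real (Suc n))) - U n \<subseteq> Z)" for n \<G>
  \<comment> \<open>The root admits all parameters and has \<open>F\<close> to cover; the clause for
    \<open>n = 0\<close> carries this starting value through the dependent choice.\<close>
  have "\<exists>\<F>. \<forall>n. (countable (\<F> n) \<and> (\<forall>P\<in>\<F> n. covers_set \<phi> D P) \<and> (n = 0 \<longrightarrow> \<F> n = {(UNIV, F)})) \<and>
      ((\<forall>P\<in>\<F> n. \<forall>y\<in>snd P \<inter> U n. \<exists>Q\<in>\<F> (Suc n). child_of D P Q \<and> y \<in> snd Q) \<and> small n (\<F> (Suc n)))"
  proof (rule dependent_nat_choice)
    show "\<exists>\<F>. countable \<F> \<and> (\<forall>P\<in>\<F>. covers_set \<phi> D P) \<and> ((0::nat) = 0 \<longrightarrow> \<F> = {(UNIV, F)})"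
      using F(2) by (intro exI[of _ "{(UNIV, F)}"]) (auto simp: covers_set_def)
  next
    fix \<F> :: "(plane set \<times> plane set) set" and n :: nat
    assume "countable \<F> \<and> (\<forall>P\<in>\<F>. covers_set \<phi> D P) \<and> (n = 0 \<longrightarrow> \<F> = {(UNIV, F)})"
    then have \<F>: "countable \<F>" "\<And>P. P \<in> \<F> \<Longrightarrow> covers_set \<phi> D P" by auto
    show "\<exists>\<G>. (countable \<G> \<and> (\<forall>P\<in>\<G>. covers_set \<phi> D P) \<and> (Suc n = 0 \<longrightarrow> \<G> = {(UNIV, F)})) \<and>
        ((\<forall>P\<in>\<F>. \<forall>y\<in>snd P \<inter> U n. \<exists>Q\<in>\<G>. child_of D P Q \<and> y \<in> snd Q) \<and> small n \<G>)"
    proof (rule refinement_step[OF D adm U(1)[of n] \<epsilon>[of n], of "real (Suc n)" \<F>])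
      fix \<G> assume \<G>: "countable \<G>" "\<And>Q. Q \<in> \<G> \<Longrightarrow> covers_set \<phi> D Q"
        "\<And>P y. P \<in> \<F> \<Longrightarrow> y \<in> snd P \<inter> U n \<Longrightarrow> \<exists>Q\<in>\<G>. child_of D P Q \<and> y \<in> snd Q"
        "\<exists>Z\<in>sets lborel. emeasure lborel Z \<le> ennreal (\<epsilon> n) \<and>
          (\<Union>Q\<in>\<G>. graph_over \<phi> D (fst Q) (real (Suc n))) - U n \<subseteq> Z"
      show ?thesis
      proof (rule exI[of _ \<G>], intro conjI impI)
        show "countable \<G>" by (rule \<G>(1))
        show "\<forall>P\<in>\<G>. covers_set \<phi> D P" using \<G>(2) by (rule ballI)
        show "\<forall>P\<in>\<F>. \<forall>y\<in>snd P \<inter> U n. \<exists>Q\<in>\<G>. child_of D P Q \<and> y \<in> snd Q"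
          using \<G>(3) by (intro ballI)
        show "small n \<G>" unfolding small_def by (rule \<G>(4))
      qed simp
    qed (use \<F> in auto)
  qed
  then obtain \<F> where *: "\<forall>n. (countable (\<F> n) \<and> (\<forall>P\<in>\<F> n. covers_set \<phi> D P) \<and> (n = 0 \<longrightarrow> \<F> n = {(UNIV, F)})) \<and>
      ((\<forall>P\<in>\<F> n. \<forall>y\<in>snd P \<inter> U n. \<exists>Q\<in>\<F> (Suc n). child_of D P Q \<and> y \<in> snd Q) \<and> small n (\<F> (Suc n)))"
    by (rule exE)
  have \<F>: "covers_set \<phi> D P" "y \<in> snd P \<inter> U n \<Longrightarrow> \<exists>Q\<in>\<F> (Suc n). child_of D P Q \<and> y \<in> snd Q"
    if "P \<in> \<F> n" for n P y
    using spec[OF *, of n] that by simp_all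
  have \<F>0: "\<F> 0 = {(UNIV, F)}" and \<F>_small: "small n (\<F> (Suc n))" for n
    using spec[OF *, of 0] spec[OF *, of n] by simp_all
  \<comment> \<open>At each level some member has to contain the parameter; members of different
    levels need not be nested.\<close>
  define E where "E = (\<Inter>n. \<Union>P\<in>\<F> (Suc n). fst P)"
  show ?thesis
  proof (rule that[of E])
    fix \<alpha> t assume y: "(\<alpha>, t) \<in> F"
    \<comment> \<open>A branch whose covered sets all contain the point; it never stops because
      \<open>F \<subseteq> U n\<close>.\<close>
    have "\<exists>P. \<forall>n. (P n \<in> \<F> n \<and> (\<alpha>, t) \<in> snd (P n)) \<and> child_of D (P n) (P (Suc n))"
    proof (rule dependent_nat_choice)
      show "\<exists>P. P \<in> \<F> 0 \<and> (\<alpha>, t) \<in> snd P" using \<F>0 y by auto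
      show "\<exists>Q. (Q \<in> \<F> (Suc n) \<and> (\<alpha>, t) \<in> snd Q) \<and> child_of D P Q"
        if "P \<in> \<F> n \<and> (\<alpha>, t) \<in> snd P" for P n
        using \<F>(2)[of P n "(\<alpha>, t)"] that U(2) y by blast
    qed
    then obtain P where P: "\<And>n. P n \<in> \<F> n" "\<And>n. (\<alpha>, t) \<in> snd (P n)" "\<And>n. child_of D (P n) (P (Suc n))"
      by blast
    have sub: "closure (fst (P (Suc n))) \<subseteq> fst (P n)" for n
      using P(3)[of n] by (simp add: child_of_def)
    \<comment> \<open>Compactness gives a parameter common to all these level sets;
      \<open>sub\<close> then moves it from the closures into the members themselves.\<close>
    define K where "K n = {x \<in> closure (fst (P (Suc n))). \<phi> (\<alpha>, x) = t}" for n
    have inD: "(\<alpha>, x) \<in> D" if "x \<in> closure (fst (P (Suc n)))" for x n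
      using P(3)[of n] P(2)[of "Suc n"] that unfolding child_of_def by blast
    have "\<Inter>(range K) \<noteq> {}"
    proof (rule compact_nest)
      fix n
      have "continuous_on (closure (fst (P (Suc n)))) (\<lambda>x. \<phi> (\<alpha>, x))"
        using adm unfolding admissible_def
        by (intro continuous_on_compose2[OF C1_on_imp_continuous_on, of \<phi> D]) (auto intro!: continuous_intros inD)
      then have "closed {x \<in> closure (fst (P (Suc n))). \<phi> (\<alpha>, x) = t}"
        by (intro continuous_closed_preimage_constant) auto
      moreover have "compact (closure (fst (P (Suc n))))"
        using P(3)[of n] by (simp add: child_of_def)
      moreover have "K n = closure (fst (P (Suc n))) \<inter> K n" by (auto simp: K_def)
      ultimately show "compact (K n)"
        using compact_Int_closed[of _ "K n"] by (metis K_def)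
      show "K n \<noteq> {}"
        using \<F>(1)[OF P(1)[of "Suc n"]] P(2)[of "Suc n"] closure_subset[of "fst (P (Suc n))"]
        unfolding K_def covers_set_def by blast
    next
      have "K (Suc n) \<subseteq> K n" for n
        using sub[of "Suc n"] closure_subset[of "fst (P (Suc n))"] by (auto simp: K_def)
      then show "K n \<subseteq> K m" if "m \<le> n" for m n
        using that by (rule lift_Suc_antimono_le)
    qed
    then obtain x where x: "\<And>n. x \<in> K n" by blast
    have "x \<in> fst (P n)" for n using x[of n] sub[of n] by (auto simp: K_def)
    then have "x \<in> E" using P(1) unfolding E_def by blast
    moreover have "(\<alpha>, x) \<in> D" "\<phi> (\<alpha>, x) = t" using x[of 0] inD[of x 0] by (auto simp: K_def)
    ultimately show "\<exists>x\<in>E. (\<alpha>, x) \<in> D \<and> \<phi> (\<alpha>, x) = t" by blast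
  next
    define C where "C m = graph_over \<phi> D E (real m) - F" for m
    have "C m \<in> null_sets lebesgue" for m
      unfolding negligible_iff_null_sets[symmetric] negligible_outer_le
    proof (intro allI impI)
      fix e :: real assume e: "e > 0"
      have "\<exists>n. (1 / 2 :: real) ^ n < e / 2" using e by (intro real_arch_pow_inv) auto
      then obtain n0 where n0: "\<epsilon> n0 < e / 2" by (auto simp: \<epsilon>_def)
      \<comment> \<open>\<open>n \<ge> m\<close> puts all parameters with
        \<open>\<bar>\<alpha>\<bar> < m\<close> into the range seen at level \<open>n + 1\<close>,
        and \<open>n \<ge> n0\<close> makes the two errors add up to less than
        \<open>e\<close>.\<close>
      define n where "n = max m n0"
      have "\<epsilon> n \<le> \<epsilon> n0" unfolding \<epsilon>_def n_def by (intro power_decreasing) auto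
      with n0 have n: "\<epsilon> n + \<epsilon> n < e" by simp
      obtain Z where Z: "Z \<in> sets lborel" "emeasure lborel Z \<le> ennreal (\<epsilon> n)"
        "(\<Union>Q\<in>\<F> (Suc n). graph_over \<phi> D (fst Q) (real (Suc n))) - U n \<subseteq> Z"
        using \<F>_small[of n] unfolding small_def by blast
      let ?T = "Z \<union> (U n - F)"
      have "C m \<subseteq> ?T"
      proof
        fix y assume "y \<in> C m"
        then obtain \<alpha> x where y: "y = (\<alpha>, \<phi> (\<alpha>, x))" "(\<alpha>, x) \<in> D" "x \<in> E" "\<bar>\<alpha>\<bar> < real m" "y \<notin> F"
          unfolding C_def graph_over_def by blast
        obtain Q where Q: "Q \<in> \<F> (Suc n)" "x \<in> fst Q" using y(3) unfolding E_def by blast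
        have "\<bar>\<alpha>\<bar> < real (Suc n)" using y(4) unfolding n_def by linarith
        then have "y \<in> graph_over \<phi> D (fst Q) (real (Suc n))"
          using y Q(2) unfolding graph_over_def by blast
        then show "y \<in> ?T" using Z(3) Q(1) y(5) by blast
      qed
      moreover have T: "?T \<in> sets lebesgue" using Z(1) U(3)[of n] by auto
      moreover have "emeasure lebesgue ?T \<le> ennreal e"
      proof -
        have "emeasure lebesgue ?T \<le> emeasure lebesgue Z + emeasure lebesgue (U n - F)"
          using Z(1) U(3)[of n] by (intro emeasure_subadditive) auto
        also have "\<dots> \<le> ennreal (\<epsilon> n) + ennreal (\<epsilon> n)"
          using Z(1,2) U(4)[of n] by (intro add_mono) auto
        also have "\<dots> = ennreal (\<epsilon> n + \<epsilon> n)" using less_imp_le[OF \<epsilon>[of n]] by (simp only: ennreal_plus)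
        also have "\<dots> \<le> ennreal e" using n by (intro ennreal_leI) auto
        finally show ?thesis .
      qed
      moreover from this have "emeasure lebesgue ?T < \<infinity>"
        by (rule le_less_trans) simp
      ultimately show "\<exists>T. C m \<subseteq> T \<and> T \<in> lmeasurable \<and> measure lebesgue T \<le> e"
        using e by (intro exI[of _ ?T]) (auto simp: measure_def intro!: fmeasurableI enn2real_leI)
    qed
    then have "(\<Union>m. C m) \<in> null_sets lebesgue" by (rule null_sets_UN)
    also have "(\<Union>m. C m) = {(\<alpha>, \<phi> (\<alpha>, x)) |\<alpha> x. (\<alpha>, x) \<in> D \<and> x \<in> E} - F"
    proof -
      have "\<exists>m. \<bar>\<alpha>\<bar> < real m" for \<alpha> :: real using reals_Archimedean2 by blast
      then show ?thesis unfolding C_def graph_over_def by blast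
    qed
    finally show "{(\<alpha>, \<phi> (\<alpha>, x)) |\<alpha> x. (\<alpha>, x) \<in> D \<and> x \<in> E} - F \<in> null_sets lebesgue" .
  qed
qed

section \<open>Reduction of the convex case to the admissible case, and conclusion\<close>

theorem theorem5p2:
  fixes D :: "(real \<times> (real \<times> real)) set"
    and \<phi> :: "real \<times> (real \<times> real) \<Rightarrow> real"
  assumes "open D"
    and "C1_on \<phi> D"
    and "(non_stationary \<phi> D \<and> angle_monotonicity \<phi> D \<and>
          extends_continuously D \<phi> \<and> grad_extends_continuously_nonzero D \<phi> \<and>
          (\<forall>\<alpha>. convex (slice D \<alpha>)))
         \<or> admissible \<phi> D"
  shows "yields_efficient_coverings {x. param_set D x \<noteq> {}} (curve \<phi> D)
           (\<Union>\<alpha>\<in>(\<Union>x. param_set D x). {\<alpha>} \<times> (\<lambda>x. \<phi> (\<alpha>, x)) ` slice D \<alpha>)"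
proof -
  have adm: "admissible \<phi> D"
    using assms(2,3) rectangle_squishing_if_convex_slices[of \<phi> D] by (auto simp: admissible_def)
  show ?thesis
    unfolding yields_efficient_coverings_def
  proof (intro allI impI, elim conjE)
    fix F assume F: "F \<in> sets lebesgue"
      and sub: "F \<subseteq> (\<Union>\<alpha>\<in>(\<Union>x. param_set D x). {\<alpha>} \<times> (\<lambda>x. \<phi> (\<alpha>, x)) ` slice D \<alpha>)"
    have "\<exists>x. (\<alpha>, x) \<in> D \<and> \<phi> (\<alpha>, x) = t" if "(\<alpha>, t) \<in> F" for \<alpha> t
      using subsetD[OF sub that] unfolding slice_def by blast
    then obtain E where E: "\<And>\<alpha> t. (\<alpha>, t) \<in> F \<Longrightarrow> \<exists>x\<in>E. (\<alpha>, x) \<in> D \<and> \<phi> (\<alpha>, x) = t"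
      "{(\<alpha>, \<phi> (\<alpha>, x)) |\<alpha> x. (\<alpha>, x) \<in> D \<and> x \<in> E} - F \<in> null_sets lebesgue"
      using efficient_covering_if_admissible[OF assms(1) adm F] by blast
    \<comment> \<open>Parameters with empty curve are dropped to stay inside the index set; the
      union does not change.\<close>
    define E' where "E' = E \<inter> {x. param_set D x \<noteq> {}}"
    have union: "(\<Union>x\<in>E'. curve \<phi> D x) = {(\<alpha>, \<phi> (\<alpha>, x)) |\<alpha> x. (\<alpha>, x) \<in> D \<and> x \<in> E}"
      unfolding E'_def curve_def param_set_def by blast
    have "F \<subseteq> (\<Union>x\<in>E'. curve \<phi> D x)"
      unfolding union
    proof
      fix y assume "y \<in> F"
      moreover obtain \<alpha> t where y: "y = (\<alpha>, t)" by (cases y)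
      ultimately obtain x where "x \<in> E" "(\<alpha>, x) \<in> D" "\<phi> (\<alpha>, x) = t" using E(1) by blast
      then show "y \<in> {(\<alpha>, \<phi> (\<alpha>, x)) |\<alpha> x. (\<alpha>, x) \<in> D \<and> x \<in> E}" unfolding y by blast
    qed
    moreover have "(\<Union>x\<in>E'. curve \<phi> D x) - F \<in> null_sets lebesgue"
      unfolding union by (rule E(2))
    moreover have "E' \<subseteq> {x. param_set D x \<noteq> {}}" by (simp add: E'_def)
    ultimately show "\<exists>E\<subseteq>{x. param_set D x \<noteq> {}}. F \<subseteq> (\<Union>x\<in>E. curve \<phi> D x) \<and>
        (\<Union>x\<in>E. curve \<phi> D x) - F \<in> null_sets lebesgue"
      by blast
  qed
qed

end
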